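(* Let $M$ and $N$ be smooth manifolds. Let $\mathcal{F}$ be a family of semi-norms satisfying the Composition property (I), the Gluing property (II) and the Monotonicity property (III). Then both the weak and strong $\mathcal{F}$-Whitney topologies on $C^{\mathcal{F}}(M,N)$ satisfy the Baire property, i.e. in each of these topologies the intersection of any countable family of open and dense subsets of $C^{\mathcal{F}}(M,N)$ is dense in $C^{\mathcal{F}}(M,N)$.
   Context: Smooth means $C^\infty$; manifolds are second countable; $m=\dim M$ and $d=\dim N$. Families of semi-norms. To each compact $K\subset\mathbb{R}^m$ is assigned a semi-norm $[\,\cdot\,]_K$ on $C^0(K,\mathbb{R}^d)$; the family of these semi-norms is denoted $\mathcal{F}$. For each compact $K\subset\mathbb{R}^m$ define the $\mathcal{F}$-norm $\|\cdot\|_K=\|\cdot\|_{C^0(K,\mathbb{R}^d)}+[\,\cdot\,]_K$, where $\|\cdot\|_{C^0(K,\mathbb{R}^d)}$ is the sup-norm, and let $C^{\mathcal{F}}(K,\mathbb{R}^d)\subset C^0(K,\mathbb{R}^d)$ denote the subspace of mappings for which $\|\cdot\|_K$ is finite. It is observed (not imposed as a hypothesis) that $C^{\mathcal{F}}(K,\mathbb{R}^d)$, endowed with this norm, is a Banach space. The properties are, for each compact set $K$: (I) Composition property. For any smooth diffeomorphisms onto their images $\psi$ and $\varphi$, there exists a positive real number $\kappa$ such that $$[\psi\circ g\circ\varphi^{-1}-\psi\circ g'\circ\varphi^{-1}]_{\varphi(K)}\le\kappa\,\|g-g'\|_K,\quad\forall g,g'\in C^{\mathcal{F}}(K,\mathbb{R}^d).$$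 Moreover, for $\|g-g'\|_K$ sufficiently small, $\kappa$ depends only upon the derivatives of $\psi$ and $\varphi$ and on $\max\{[g]_K,[g']_K\}$. (II) Gluing property. Given a finite collection of compact sets $\{K_s\}_{s\in S}$, let $K=\bigcup_{s\in S}K_s$. There exists a positive real number $C$, depending upon $\{K_s\}_{s\in S}$ only, such that $[g]_K\le C\sum_{s\in S}[g]_{K_s}$ for all $g\in C^{\mathcal{F}}(K,\mathbb{R}^d)$. (III) Monotonicity property. If $K'\subset K$ then $[g]_{K'}\le[g]_K$ for all $g\in C^{\mathcal{F}}(K,\mathbb{R}^d)$. Whitney topologies. $C^{\mathcal{F}}(M,N)$ is the set of mappings $f\in C^0(M,N)$ such that in local charts $f$ has finite $\mathcal{F}$-norm on each compact subset. Weak topology. For a chart $(U,\varphi)$ in $M$, a chart $(V,\psi)$ in $N$, a compact subset $K$ of $U$, a positive extended real number $\epsilon$, and $f\in C^{\mathcal{F}}(M,N)$ satisfying $f(K)\subset V$, let $\mathcal{N}(f;(U,\varphi),(V,\psi),K,\epsilon)$ be the set of $g\in C^{\mathcal{F}}(M,N)$ satisfying $g(K)\subset V$ and $\|\psi\circ f\circ\varphi^{-1}-\psi\circ g\circ\varphi^{-1}\|_{\varphi(K)}<\epsilon$. The weak $\mathcal{F}$-Whitney topology is the topology generated by these sets (they form a sub-base). Strong topology. For a locally finite collection of charts $\Phi=\{(U_t,\varphi_t)\}_{t\in T}$ on $M$, a collection of charts $\Psi=\{(V_t,\psi_t)\}_{t\in T}$ on $N$, a collection $K=\{K_t\}_{t\in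 T}$ of compact sets with $K_t\subset U_t$, a collection $\epsilon=\{\epsilon_t\}_{t\in T}$ of positive extended real numbers, and $f\in C^{\mathcal{F}}(M,N)$ satisfying $f(K_t)\subset V_t$ for each $t\in T$, let $\mathcal{N}_s(f;\Phi,\Psi,K,\epsilon)$ be the set of $g\in C^{\mathcal{F}}(M,N)$ such that, for each $t\in T$, $g(K_t)\subset V_t$ and $\|\psi_t\circ f\circ\varphi_t^{-1}-\psi_t\circ g\circ\varphi_t^{-1}\|_{\varphi_t(K_t)}<\epsilon_t$. The strong $\mathcal{F}$-Whitney topology is the topology with the collection of all these sets as a base.
   Formalization: It is assumed that each C^F(K,R^d) with the F-norm is a Banach space; this does not follow from (I)-(III), and without it the claim fails (e.g. [g]_K = 0 if pointwise Lipschitz constants of g on K are bounded, infinite otherwise). *)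

theory Defs
  imports "HOL-Analysis.Analysis"
begin

section \<open>Model spaces and smooth maps\<close>

text \<open>
  The Euclidean space of dimension \<open>k\<close> is any \<open>k\<close>-dimensional real inner product space. The class
  \<open>euclidean_space\<close> is avoided only because it excludes dimension zero.
\<close>

definition has_dimension :: "'v::real_inner itself \<Rightarrow> nat \<Rightarrow> bool" where
  "has_dimension _ k \<longleftrightarrow>
     (\<exists>B::'v set. finite B \<and> independent B \<and> span B = UNIV \<and> card B = k)"

fun iterated_derivative ::
    "'v list \<Rightarrow> ('v::real_normed_vector \<Rightarrow> 'w::real_normed_vector) \<Rightarrow> 'v \<Rightarrow> 'w" where
  "iterated_derivative [] f = f"
| "iterated_derivative (v # vs) f =
     (\<lambda>x. frechet_derivative (iterated_derivative vs f) (at x) v)"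

text \<open>
  Differentiability of all iterated directional derivatives entails their continuity, so on
  finite-dimensional spaces this is the class \<open>C\<^sup>\<infinity>\<close>.
\<close>

definition smooth_on :: "'v set \<Rightarrow> ('v::real_normed_vector \<Rightarrow> 'w::real_normed_vector) \<Rightarrow> bool" where
  "smooth_on U f \<longleftrightarrow> open U \<and> (\<forall>vs. \<forall>x\<in>U. iterated_derivative vs f differentiable (at x))"

definition smooth_diffeo_onto_image :: "'v set \<Rightarrow> ('v::real_normed_vector \<Rightarrow> 'v) \<Rightarrow> bool" where
  "smooth_diffeo_onto_image U f \<longleftrightarrow>
     smooth_on U f \<and> inj_on f U \<and> smooth_on (f ` U) (inv_into U f)"

text \<open>All derivatives of \<open>f\<close> of order at least one, as functions on \<open>U\<close>.\<close>

definition derivatives_on ::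
    "'v set \<Rightarrow> ('v::real_normed_vector \<Rightarrow> 'v) \<Rightarrow> 'v list \<Rightarrow> 'v \<Rightarrow> 'v" where
  "derivatives_on U f = (\<lambda>vs\<in>{vs. vs \<noteq> []}. \<lambda>x\<in>U. iterated_derivative vs f x)"


section \<open>Smooth manifolds\<close>

text \<open>A chart \<open>(U, \<phi>)\<close>; the values of \<open>\<phi>\<close> outside \<open>U\<close> are irrelevant.\<close>

type_synonym ('a, 'v) chart = "'a set \<times> ('a \<Rightarrow> 'v)"

definition is_chart :: "('a::topological_space, 'v::real_normed_vector) chart \<Rightarrow> bool" where
  "is_chart = (\<lambda>(U, \<phi>).
     open U \<and> open (\<phi> ` U) \<and> homeomorphism U (\<phi> ` U) \<phi> (inv_into U \<phi>))"

definition smoothly_compatible ::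
    "('a, 'v::real_normed_vector) chart \<Rightarrow> ('a, 'v) chart \<Rightarrow> bool" where
  "smoothly_compatible = (\<lambda>(U, \<phi>) (V, \<psi>).
     smooth_on (\<phi> ` (U \<inter> V)) (\<psi> \<circ> inv_into U \<phi>) \<and>
     smooth_on (\<psi> ` (U \<inter> V)) (\<phi> \<circ> inv_into V \<psi>))"

text \<open>
  A smooth structure is a maximal smooth atlas. The manifold is the whole type \<open>'a\<close>, and the charts
  of the manifold are the members of the atlas.
\<close>

definition smooth_structure ::
    "('a::{t2_space, second_countable_topology}, 'v::real_inner) chart set \<Rightarrow> bool" where
  "smooth_structure A \<longleftrightarrow>
     (\<forall>c\<in>A. is_chart c) \<and>
     (\<Union>c\<in>A. fst c) = UNIV \<and>
     (\<forall>c\<in>A. \<forall>c'\<in>A. smoothly_compatible c c') \<and>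
     (\<forall>c. is_chart c \<and> (\<forall>c'\<in>A. smoothly_compatible c c') \<longrightarrow> c \<in> A)"


section \<open>Families of semi-norms\<close>

text \<open>
  \<open>F K g\<close> is the semi-norm of the restriction of \<open>g\<close> to the compact set \<open>K\<close>. Semi-norms may take
  the value \<open>\<infinity>\<close>. Only the values of \<open>F K g\<close> for compact \<open>K\<close> and \<open>g\<close> continuous on \<open>K\<close> matter.
\<close>

type_synonym ('v, 'w) seminorms = "'v set \<Rightarrow> ('v \<Rightarrow> 'w) \<Rightarrow> ennreal"

definition seminorm_family :: "('v::real_inner, 'w::real_inner) seminorms \<Rightarrow> bool" where
  "seminorm_family F \<longleftrightarrow> (\<forall>K. compact K \<longrightarrow>
     (\<forall>g h. continuous_on K g \<longrightarrow> (\<forall>x\<in>K. g x = h x) \<longrightarrow> F K g = F K h) \<and>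
     (\<forall>g h. continuous_on K g \<longrightarrow> continuous_on K h \<longrightarrow>
        F K (\<lambda>x. g x + h x) \<le> F K g + F K h) \<and>
     (\<forall>g c. continuous_on K g \<longrightarrow> F K (\<lambda>x. c *\<^sub>R g x) = ennreal \<bar>c\<bar> * F K g))"

definition sup_norm :: "'v set \<Rightarrow> ('v \<Rightarrow> 'w::real_normed_vector) \<Rightarrow> ennreal" where
  "sup_norm K g = (SUP x\<in>K. ennreal (norm (g x)))"

definition F_norm ::
    "('v, 'w::real_normed_vector) seminorms \<Rightarrow> 'v set \<Rightarrow> ('v \<Rightarrow> 'w) \<Rightarrow> ennreal" where
  "F_norm F K g = sup_norm K g + F K g"

definition CF_compact ::
    "('v::real_inner, 'w::real_inner) seminorms \<Rightarrow> 'v set \<Rightarrow> ('v \<Rightarrow> 'w) set" where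
  "CF_compact F K = {g. continuous_on K g \<and> F_norm F K g < \<infinity>}"

text \<open>
  Completeness of all the spaces \<open>C\<^sup>F(K)\<close>. This does not follow from the three properties below, and
  the Baire property fails without it: let \<open>F K g\<close> be \<open>0\<close> if the pointwise Lipschitz constants of
  \<open>g\<close> on \<open>K\<close> are bounded and \<open>\<infinity>\<close> otherwise. The three properties hold, but the locally Lipschitz
  maps \<open>\<real> \<rightarrow> \<real>\<close> with the topology of locally uniform convergence are a countable union of closed
  sets with empty interior, namely those of the maps that are \<open>n\<close>-Lipschitz on \<open>[0, 1]\<close>.
\<close>

definition banach_family :: "('v::real_inner, 'w::real_inner) seminorms \<Rightarrow> bool" where
  "banach_family F \<longleftrightarrow> (\<forall>K. compact K \<longrightarrow>
     (\<forall>g::nat \<Rightarrow> 'v \<Rightarrow> 'w.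
        (\<forall>n. g n \<in> CF_compact F K) \<and>
        (\<forall>e>0. \<exists>n0. \<forall>i\<ge>n0. \<forall>j\<ge>n0. F_norm F K (\<lambda>x. g i x - g j x) < e) \<longrightarrow>
        (\<exists>l\<in>CF_compact F K. (\<lambda>n. F_norm F K (\<lambda>x. g n x - l x)) \<longlonglongrightarrow> 0)))"

text \<open>
  The constant may depend on \<open>g\<close> and \<open>g'\<close>; the second part limits this dependence for nearby maps.
  There \<open>L\<close> is a compact region containing the values of \<open>g\<close> and \<open>g'\<close>, over which the derivatives
  of \<open>\<psi>\<close> are bounded, and \<open>R\<close> bounds the maximum of the two semi-norms.
\<close>

definition composition_property :: "('v::real_inner, 'w::real_inner) seminorms \<Rightarrow> bool" where
  "composition_property F \<longleftrightarrow> (\<forall>K. compact K \<longrightarrow>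
     (\<forall>U \<phi> V \<psi>. smooth_diffeo_onto_image U \<phi> \<and> K \<subseteq> U \<and> smooth_diffeo_onto_image V \<psi> \<longrightarrow>
        (\<forall>g\<in>CF_compact F K. \<forall>g'\<in>CF_compact F K. g ` K \<subseteq> V \<and> g' ` K \<subseteq> V \<longrightarrow>
           (\<exists>\<kappa>::real. \<kappa> > 0 \<and>
              F (\<phi> ` K) (\<lambda>y. \<psi> (g (inv_into U \<phi> y)) - \<psi> (g' (inv_into U \<phi> y)))
                \<le> ennreal \<kappa> * F_norm F K (\<lambda>x. g x - g' x)))) \<and>
     (\<exists>\<kappa> :: ('w list \<Rightarrow> 'w \<Rightarrow> 'w) \<Rightarrow> ('v list \<Rightarrow> 'v \<Rightarrow> 'v) \<Rightarrow> 'w set \<Rightarrow> real \<Rightarrow> real.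
        \<forall>U \<phi> V \<psi> L R.
          smooth_diffeo_onto_image U \<phi> \<and> K \<subseteq> U \<and>
          smooth_diffeo_onto_image V \<psi> \<and> compact L \<and> L \<subseteq> V \<longrightarrow>
          \<kappa> (derivatives_on V \<psi>) (derivatives_on U \<phi>) L R > 0 \<and>
          (\<forall>g\<in>CF_compact F K. g ` K \<subseteq> L \<longrightarrow>
             (\<exists>\<delta>>0. \<forall>g'\<in>CF_compact F K.
                g' ` K \<subseteq> L \<and> F_norm F K (\<lambda>x. g x - g' x) < \<delta> \<and>
                max (F K g) (F K g') \<le> ennreal R \<longrightarrow>
                F (\<phi> ` K) (\<lambda>y. \<psi> (g (inv_into U \<phi> y)) - \<psi> (g' (inv_into U \<phi> y)))
                  \<le> ennreal (\<kappa> (derivatives_on V \<psi>) (derivatives_on U \<phi>) L R)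
                     * F_norm F K (\<lambda>x. g x - g' x)))))"

definition gluing_property :: "('v::real_inner, 'w::real_inner) seminorms \<Rightarrow> bool" where
  "gluing_property F \<longleftrightarrow> (\<forall>\<K>. finite \<K> \<and> (\<forall>K\<in>\<K>. compact K) \<longrightarrow>
     (\<exists>C::real. C > 0 \<and>
        (\<forall>g\<in>CF_compact F (\<Union>\<K>). F (\<Union>\<K>) g \<le> ennreal C * (\<Sum>K\<in>\<K>. F K g))))"

definition monotonicity_property :: "('v::real_inner, 'w::real_inner) seminorms \<Rightarrow> bool" where
  "monotonicity_property F \<longleftrightarrow> (\<forall>K K'. compact K \<and> compact K' \<and> K' \<subseteq> K \<longrightarrow>
     (\<forall>g\<in>CF_compact F K. F K' g \<le> F K g))"


section \<open>Whitney topologies\<close>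

fun local_rep :: "('a, 'v) chart \<Rightarrow> ('b, 'w) chart \<Rightarrow> ('a \<Rightarrow> 'b) \<Rightarrow> 'v \<Rightarrow> 'w" where
  "local_rep (U, \<phi>) (V, \<psi>) f = \<psi> \<circ> f \<circ> inv_into U \<phi>"

definition CF ::
    "('v::real_inner, 'w::real_inner) seminorms \<Rightarrow>
     ('a::topological_space, 'v) chart set \<Rightarrow> ('b::topological_space, 'w) chart set \<Rightarrow>
     ('a \<Rightarrow> 'b) set" where
  "CF F A B = {f. continuous_on UNIV f \<and>
     (\<forall>c\<in>A. \<forall>c'\<in>B. \<forall>K. compact K \<and> K \<subseteq> fst c \<and> f ` K \<subseteq> fst c' \<longrightarrow>
        local_rep c c' f \<in> CF_compact F (snd c ` K))}"

text \<open>The data \<open>((U, \<phi>), (V, \<psi>), K, \<epsilon>)\<close> of one neighbourhood condition.\<close>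

type_synonym ('a, 'v, 'b, 'w) nbhd_data =
  "('a, 'v) chart \<times> ('b, 'w) chart \<times> 'a set \<times> ennreal"

definition admissible ::
    "('a::topological_space, 'v) chart set \<Rightarrow> ('b, 'w) chart set \<Rightarrow> ('a \<Rightarrow> 'b) \<Rightarrow>
     ('a, 'v, 'b, 'w) nbhd_data \<Rightarrow> bool" where
  "admissible A B f = (\<lambda>(c, c', K, \<epsilon>).
     c \<in> A \<and> c' \<in> B \<and> compact K \<and> K \<subseteq> fst c \<and> f ` K \<subseteq> fst c' \<and> \<epsilon> > 0)"

definition weak_nbhd ::
    "('v::real_inner, 'w::real_inner) seminorms \<Rightarrow>
     ('a::topological_space, 'v) chart set \<Rightarrow> ('b::topological_space, 'w) chart set \<Rightarrow>
     ('a \<Rightarrow> 'b) \<Rightarrow> ('a, 'v, 'b, 'w) nbhd_data \<Rightarrow> ('a \<Rightarrow> 'b) set" where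
  "weak_nbhd F A B f = (\<lambda>(c, c', K, \<epsilon>).
     {g \<in> CF F A B. g ` K \<subseteq> fst c' \<and>
        F_norm F (snd c ` K) (\<lambda>y. local_rep c c' f y - local_rep c c' g y) < \<epsilon>})"

definition weak_whitney_topology ::
    "('v::real_inner, 'w::real_inner) seminorms \<Rightarrow>
     ('a::topological_space, 'v) chart set \<Rightarrow> ('b::topological_space, 'w) chart set \<Rightarrow>
     ('a \<Rightarrow> 'b) topology" where
  "weak_whitney_topology F A B =
     topology_generated_by {weak_nbhd F A B f q | f q. f \<in> CF F A B \<and> admissible A B f q}"

text \<open>
  A family indexed by \<open>t\<close> of data \<open>((U\<^sub>t, \<phi>\<^sub>t), (V\<^sub>t, \<psi>\<^sub>t), K\<^sub>t, \<epsilon>\<^sub>t)\<close> is rendered as the set \<open>Q\<close> of these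
  quadruples, indexed by itself. Repetitions of a quadruple do not affect the resulting neighbourhood.
\<close>

definition locally_finite_charts :: "('a::topological_space, 'v, 'b, 'w) nbhd_data set \<Rightarrow> bool" where
  "locally_finite_charts Q \<longleftrightarrow>
     (\<forall>x. \<exists>W. open W \<and> x \<in> W \<and> finite {q \<in> Q. fst (fst q) \<inter> W \<noteq> {}})"

definition strong_nbhd ::
    "('v::real_inner, 'w::real_inner) seminorms \<Rightarrow>
     ('a::topological_space, 'v) chart set \<Rightarrow> ('b::topological_space, 'w) chart set \<Rightarrow>
     ('a \<Rightarrow> 'b) \<Rightarrow> ('a, 'v, 'b, 'w) nbhd_data set \<Rightarrow> ('a \<Rightarrow> 'b) set" where
  "strong_nbhd F A B f Q = {g \<in> CF F A B. \<forall>q\<in>Q. g \<in> weak_nbhd F A B f q}"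

definition strong_base ::
    "('v::real_inner, 'w::real_inner) seminorms \<Rightarrow>
     ('a::topological_space, 'v) chart set \<Rightarrow> ('b::topological_space, 'w) chart set \<Rightarrow>
     ('a \<Rightarrow> 'b) set set" where
  "strong_base F A B = {strong_nbhd F A B f Q | f Q.
     f \<in> CF F A B \<and> locally_finite_charts Q \<and> (\<forall>q\<in>Q. admissible A B f q)}"

definition strong_whitney_topology ::
    "('v::real_inner, 'w::real_inner) seminorms \<Rightarrow>
     ('a::topological_space, 'v) chart set \<Rightarrow> ('b::topological_space, 'w) chart set \<Rightarrow>
     ('a \<Rightarrow> 'b) topology" where
  "strong_whitney_topology F A B = topology (arbitrary union_of (\<lambda>W. W \<in> strong_base F A B))"

definition baire_property :: "'x topology \<Rightarrow> bool" where
  "baire_property X \<longleftrightarrow>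
     (\<forall>\<U>. countable \<U> \<and> (\<forall>U\<in>\<U>. openin X U \<and> X closure_of U = topspace X) \<longrightarrow>
        X closure_of (topspace X \<inter> \<Inter>\<U>) = topspace X)"

section \<open>Well-definedness of the topologies\<close>

lemma F_norm_diff_self:
  assumes "seminorm_family F" "compact K" "continuous_on K g"
  shows "F_norm F K (\<lambda>x. g x - g x) = 0"
proof -
  have "F K (\<lambda>x. 0 *\<^sub>R g x) = ennreal \<bar>0\<bar> * F K g"
    using assms unfolding seminorm_family_def by blast
  moreover have "sup_norm K (\<lambda>x. g x - g x) = 0"
    by (cases "K = {}") (simp_all add: sup_norm_def bot_ennreal)
  ultimately show ?thesis
    by (simp add: F_norm_def)
qed

lemma F_norm_diff_triangle:
  assumes "seminorm_family F" "compact K"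
    and "continuous_on K f" "continuous_on K g" "continuous_on K h"
  shows "F_norm F K (\<lambda>x. f x - h x) \<le> F_norm F K (\<lambda>x. f x - g x) + F_norm F K (\<lambda>x. g x - h x)"
proof -
  have fg: "continuous_on K (\<lambda>x. f x - g x)" and gh: "continuous_on K (\<lambda>x. g x - h x)"
    using assms by (auto intro!: continuous_intros)
  have "F K (\<lambda>x. (f x - g x) + (g x - h x)) \<le> F K (\<lambda>x. f x - g x) + F K (\<lambda>x. g x - h x)"
    using assms(1,2) fg gh unfolding seminorm_family_def by blast
  then have 1: "F K (\<lambda>x. f x - h x) \<le> F K (\<lambda>x. f x - g x) + F K (\<lambda>x. g x - h x)"
    by simp
  have "ennreal (norm (f x - h x))
      \<le> sup_norm K (\<lambda>x. f x - g x) + sup_norm K (\<lambda>x. g x - h x)" if "x \<in> K" for x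
  proof -
    have "ennreal (norm (f x - h x)) \<le> ennreal (norm (f x - g x) + norm (g x - h x))"
      using norm_triangle_ineq[of "f x - g x" "g x - h x"] by (intro ennreal_leI) simp
    also have "\<dots> = ennreal (norm (f x - g x)) + ennreal (norm (g x - h x))"
      by simp
    also have "\<dots> \<le> sup_norm K (\<lambda>x. f x - g x) + sup_norm K (\<lambda>x. g x - h x)"
      unfolding sup_norm_def using that by (intro add_mono SUP_upper)
    finally show ?thesis .
  qed
  then have 2: "sup_norm K (\<lambda>x. f x - h x)
      \<le> sup_norm K (\<lambda>x. f x - g x) + sup_norm K (\<lambda>x. g x - h x)"
    unfolding sup_norm_def[of K "\<lambda>x. f x - h x"] by (rule SUP_least)
  show ?thesis
    unfolding F_norm_def using add_mono[OF 2 1] by (simp add: ac_simps)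
qed

context
  fixes F :: "('v::real_inner, 'w::real_inner) seminorms"
    and A :: "('a::{t2_space, second_countable_topology}, 'v) chart set"
    and B :: "('b::{t2_space, second_countable_topology}, 'w) chart set"
  assumes A: "smooth_structure A" and B: "smooth_structure B" and F: "seminorm_family F"
begin

lemma local_rep_continuous:
  assumes "f \<in> CF F A B" "c \<in> A" "c' \<in> B" "compact K" "K \<subseteq> fst c" "f ` K \<subseteq> fst c'"
  shows "compact (snd c ` K)" "continuous_on (snd c ` K) (local_rep c c' f)"
proof -
  have "is_chart c"
    using A assms(2) unfolding smooth_structure_def by blast
  then have "continuous_on (fst c) (snd c)"
    unfolding is_chart_def homeomorphism_def by (cases c) auto
  then show "compact (snd c ` K)"
    using assms continuous_on_subset compact_continuous_image by metis
  show "continuous_on (snd c ` K) (local_rep c c' f)"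
    using assms unfolding CF_def CF_compact_def by blast
qed

lemma self_in_weak_nbhd:
  assumes "f \<in> CF F A B" "admissible A B f q"
  shows "f \<in> weak_nbhd F A B f q"
proof -
  obtain c c' K e where q: "q = (c, c', K, e)" by (metis surj_pair)
  have "compact (snd c ` K)" "continuous_on (snd c ` K) (local_rep c c' f)"
    using local_rep_continuous[of f c c' K] assms unfolding admissible_def q by simp_all
  then show ?thesis
    using F_norm_diff_self[OF F] assms unfolding weak_nbhd_def admissible_def q by auto
qed

lemma weak_nbhd_recentre:
  assumes f: "f \<in> CF F A B" and q: "admissible A B f q" and g: "g \<in> weak_nbhd F A B f q"
  obtains e where "admissible A B g (fst q, fst (snd q), fst (snd (snd q)), e)"
    and "weak_nbhd F A B g (fst q, fst (snd q), fst (snd (snd q)), e) \<subseteq> weak_nbhd F A B f q"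
proof -
  obtain c c' K e where qq: "q = (c, c', K, e)" by (metis surj_pair)
  define d where "d = F_norm F (snd c ` K) (\<lambda>y. local_rep c c' f y - local_rep c c' g y)"
  have g': "g \<in> CF F A B" "g ` K \<subseteq> fst c'" "d < e"
    using g unfolding weak_nbhd_def qq d_def by auto
  have ad: "c \<in> A" "c' \<in> B" "compact K" "K \<subseteq> fst c" "f ` K \<subseteq> fst c'"
    using q unfolding admissible_def qq by auto
  have "admissible A B g (c, c', K, e - d)"
    using ad g' unfolding admissible_def by (auto simp: diff_gr0_ennreal)
  moreover have "h \<in> weak_nbhd F A B f q" if "h \<in> weak_nbhd F A B g (c, c', K, e - d)" for h
  proof -
    define d' where "d' = F_norm F (snd c ` K) (\<lambda>y. local_rep c c' g y - local_rep c c' h y)"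
    have h: "h \<in> CF F A B" "h ` K \<subseteq> fst c'" "d' < e - d"
      using that unfolding weak_nbhd_def d'_def by auto
    have "F_norm F (snd c ` K) (\<lambda>y. local_rep c c' f y - local_rep c c' h y) \<le> d + d'"
      unfolding d_def d'_def
      using local_rep_continuous[OF _ ad(1-4)] f g' h ad
      by (intro F_norm_diff_triangle[OF F]) auto
    also have "\<dots> < d + (e - d)"
      using h(3) g'(3) by (metis ennreal_add_left_cancel_less infinity_ennreal_def top.extremum_strict top.not_eq_extremum)
    also have "\<dots> = e"
      using g'(3) by (simp add: add_diff_inverse_ennreal)
    finally show ?thesis
      using h unfolding weak_nbhd_def qq by auto
  qed
  ultimately show thesis
    using that[of "e - d"] unfolding qq by auto
qed

lemma topspace_weak_whitney_topology: "topspace (weak_whitney_topology F A B) = CF F A B"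
proof -
  obtain c c' where c: "c \<in> A" "c' \<in> B"
    using A B unfolding smooth_structure_def by blast
  have "f \<in> \<Union>{weak_nbhd F A B f q |f q. f \<in> CF F A B \<and> admissible A B f q}"
    if "f \<in> CF F A B" for f
  proof -
    have "admissible A B f (c, c', {}, 1)"
      using c unfolding admissible_def by simp
    then show ?thesis
      using self_in_weak_nbhd that by blast
  qed
  moreover have "weak_nbhd F A B f q \<subseteq> CF F A B" for f q
    unfolding weak_nbhd_def by (auto split: prod.splits)
  ultimately show ?thesis
    unfolding weak_whitney_topology_def topology_generated_by_topspace by blast
qed

lemma strong_base_refine:
  assumes S: "S \<in> strong_base F A B" and T: "T \<in> strong_base F A B" and g: "g \<in> S \<inter> T"
  shows "\<exists>W \<in> strong_base F A B. g \<in> W \<and> W \<subseteq> S \<inter> T"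
proof -
  have *: "\<exists>Q. locally_finite_charts Q \<and> (\<forall>q\<in>Q. admissible A B g q) \<and> strong_nbhd F A B g Q \<subseteq> S"
    if "S \<in> strong_base F A B" "g \<in> S" for S
  proof -
    obtain f P where f: "f \<in> CF F A B" and P: "locally_finite_charts P"
      "\<forall>q\<in>P. admissible A B f q" and S: "S = strong_nbhd F A B f P"
      using \<open>S \<in> strong_base F A B\<close> unfolding strong_base_def by blast
    have "\<forall>q\<in>P. \<exists>e. admissible A B g (fst q, fst (snd q), fst (snd (snd q)), e) \<and>
        weak_nbhd F A B g (fst q, fst (snd q), fst (snd (snd q)), e) \<subseteq> weak_nbhd F A B f q"
    proof
      fix q assume "q \<in> P"
      then have "admissible A B f q" "g \<in> weak_nbhd F A B f q"
        using P(2) \<open>g \<in> S\<close> unfolding S strong_nbhd_def by blast+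
      from weak_nbhd_recentre[OF f this]
      show "\<exists>e. admissible A B g (fst q, fst (snd q), fst (snd (snd q)), e) \<and>
          weak_nbhd F A B g (fst q, fst (snd q), fst (snd (snd q)), e) \<subseteq> weak_nbhd F A B f q"
        by blast
    qed
    from bchoice[OF this] obtain e where e: "\<And>q. q \<in> P \<Longrightarrow>
        admissible A B g (fst q, fst (snd q), fst (snd (snd q)), e q)"
      "\<And>q. q \<in> P \<Longrightarrow>
        weak_nbhd F A B g (fst q, fst (snd q), fst (snd (snd q)), e q) \<subseteq> weak_nbhd F A B f q"
      by blast
    define h where "h q = (fst q, fst (snd q), fst (snd (snd q)), e q)" for q
    define Q where "Q = h ` P"
    have fst_h: "fst (h q) = fst q" for q
      unfolding h_def by simp
    have "locally_finite_charts Q"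
      unfolding locally_finite_charts_def
    proof
      fix x
      obtain W where W: "open W" "x \<in> W" "finite {q \<in> P. fst (fst q) \<inter> W \<noteq> {}}"
        using P(1) unfolding locally_finite_charts_def by blast
      have "{q \<in> Q. fst (fst q) \<inter> W \<noteq> {}} \<subseteq> h ` {q \<in> P. fst (fst q) \<inter> W \<noteq> {}}"
        unfolding Q_def using fst_h by (intro subsetI, elim CollectE conjE imageE) simp
      then have "finite {q \<in> Q. fst (fst q) \<inter> W \<noteq> {}}"
        using W(3) finite_surj by blast
      then show "\<exists>W. open W \<and> x \<in> W \<and> finite {q \<in> Q. fst (fst q) \<inter> W \<noteq> {}}"
        using W by blast
    qed
    moreover have "\<forall>q\<in>Q. admissible A B g q"
      unfolding Q_def h_def using e(1) by blast
    moreover have "strong_nbhd F A B g Q \<subseteq> S"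
      unfolding S strong_nbhd_def Q_def h_def using e(2) by blast
    ultimately show ?thesis by blast
  qed
  obtain P where P: "locally_finite_charts P" "\<forall>q\<in>P. admissible A B g q"
    "strong_nbhd F A B g P \<subseteq> S"
    using *[OF S] g by blast
  obtain Q where Q: "locally_finite_charts Q" "\<forall>q\<in>Q. admissible A B g q"
    "strong_nbhd F A B g Q \<subseteq> T"
    using *[OF T] g by blast
  have gCF: "g \<in> CF F A B"
    using S g unfolding strong_base_def strong_nbhd_def by blast
  have "locally_finite_charts (P \<union> Q)"
    unfolding locally_finite_charts_def
  proof
    fix x
    obtain W where W: "open W" "x \<in> W" "finite {q \<in> P. fst (fst q) \<inter> W \<noteq> {}}"
      using P(1) unfolding locally_finite_charts_def by blast
    obtain W' where W': "open W'" "x \<in> W'" "finite {q \<in> Q. fst (fst q) \<inter> W' \<noteq> {}}"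
      using Q(1) unfolding locally_finite_charts_def by blast
    have "finite {q \<in> P \<union> Q. fst (fst q) \<inter> (W \<inter> W') \<noteq> {}}"
      by (rule finite_subset[OF _ finite_UnI[OF W(3) W'(3)]]) auto
    then show "\<exists>W. open W \<and> x \<in> W \<and> finite {q \<in> P \<union> Q. fst (fst q) \<inter> W \<noteq> {}}"
      using W W' by (meson IntI open_Int)
  qed
  then have "strong_nbhd F A B g (P \<union> Q) \<in> strong_base F A B"
    using P(2) Q(2) gCF unfolding strong_base_def by blast
  moreover have "g \<in> strong_nbhd F A B g (P \<union> Q)"
    using self_in_weak_nbhd gCF P(2) Q(2) unfolding strong_nbhd_def by blast
  moreover have "strong_nbhd F A B g (P \<union> Q) \<subseteq> S \<inter> T"
    using P(3) Q(3) unfolding strong_nbhd_def by blast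
  ultimately show ?thesis by blast
qed

lemma openin_strong_whitney_topology:
  "openin (strong_whitney_topology F A B) = arbitrary union_of (\<lambda>W. W \<in> strong_base F A B)"
proof -
  have "(arbitrary union_of (\<lambda>W. W \<in> strong_base F A B)) (S \<inter> T)"
    if ST: "S \<in> strong_base F A B" "T \<in> strong_base F A B" for S T
  proof -
    have "S \<inter> T = \<Union>{W \<in> strong_base F A B. W \<subseteq> S \<inter> T}"
      using strong_base_refine[OF ST] by (intro equalityI subsetI) blast+
    then show ?thesis
      unfolding union_of_def arbitrary_def
      by (intro exI[of _ "{W \<in> strong_base F A B. W \<subseteq> S \<inter> T}"]) auto
  qed
  then show ?thesis
    unfolding strong_whitney_topology_def
    by (intro topology_inverse') (simp add: istopology_base_eq)
qed

lemma topspace_strong_whitney_topology: "topspace (strong_whitney_topology F A B) = CF F A B"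
proof -
  have "strong_nbhd F A B f {} \<in> strong_base F A B \<and> strong_nbhd F A B f {} = CF F A B"
    if "f \<in> CF F A B" for f
  proof
    have "locally_finite_charts {}"
      unfolding locally_finite_charts_def by (simp add: exI[of _ UNIV])
    then show "strong_nbhd F A B f {} \<in> strong_base F A B"
      using that unfolding strong_base_def by blast
    show "strong_nbhd F A B f {} = CF F A B"
      unfolding strong_nbhd_def by simp
  qed
  then have "CF F A B \<subseteq> \<Union>(strong_base F A B)"
    by blast
  moreover have "\<Union>(strong_base F A B) \<subseteq> CF F A B"
    unfolding strong_base_def strong_nbhd_def by blast
  moreover have "topspace (strong_whitney_topology F A B) = \<Union>(strong_base F A B)"
    unfolding topspace_def openin_strong_whitney_topology union_of_def arbitrary_def by auto
  ultimately show ?thesis by blast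
qed

end

end

theory Submission
  imports Defs
begin

text \<open>
  Both topologies have the same kind of neighbourhoods of a map \<open>f\<close>: the maps that are close to \<open>f\<close>
  in the \<open>F\<close>-norm on each member of a family of compact pieces, read in charts. The weak topology uses
  finite families, the strong one locally finite families. The strong topology is in general not
  metrisable, so Baire's theorem for complete metric spaces does not apply. The way out is that only
  weak convergence is needed to carry out Baire's construction: neighbourhoods in either topology contain
  closed neighbourhoods, given by non-strict inequalities, that are closed under weak limits.

  Given dense open sets \<open>U n\<close> and an open set \<open>W\<close>, one chooses maps \<open>f n\<close> and decreasing closed
  neighbourhoods of \<open>f n\<close> inside \<open>U n \<inter> W\<close> (\<open>dense_sequence_meets_open\<close>). At stage \<open>n\<close> the
  family is enlarged by finitely many pieces that cover the \<open>n\<close>-th set of a countable cover of \<open>M\<close> by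
  compact sets and that \<open>f n\<close> maps into charts, and all radii are made at most \<open>1 / (n + 1)\<close>
  and so small that nearby maps take their values in a compact part of the target chart. Then \<open>f n\<close> is
  Cauchy on pieces that cover \<open>M\<close>, and its limit lies in all the neighbourhoods
  (\<open>nested_nbhds_common_point\<close>).

  The analytic part is the existence of this limit in \<open>C\<^sup>F(M, N)\<close>, \<open>weak_limit_exists\<close>.
  Completeness gives local limits, which fit together to a continuous map \<open>g\<close>. That \<open>g\<close> has finite norm
  in every pair of charts is the point where the three properties enter. Monotonicity restricts
  convergence to smaller compact sets. The composition property transports it to other charts
  (\<open>change_of_charts\<close>): near the fixed map \<open>g\<close> it provides a uniform Lipschitz constant. The gluing
  property assembles finitely many pieces (\<open>glue_convergence\<close>); as it bounds only norms known to be
  finite, it is applied to differences \<open>f i - f j\<close>, and completeness is used once more.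
\<close>

section \<open>Finite-dimensional model spaces\<close>

text \<open>
  Model spaces are inner product spaces with a finite spanning set, possibly of dimension zero. Their
  local compactness comes from the fact that such a box of coefficients is a continuous image of a
  product of compact intervals; for an orthogonal spanning set a ball lies in such a box.
\<close>

lemma compact_bounded_combinations:
  fixes C :: "'v::real_normed_vector set"
  assumes "finite C"
  shows "compact {(\<Sum>c\<in>C. a c *\<^sub>R c) |a. \<forall>c\<in>C. \<bar>a c\<bar> \<le> r c}"
  using assms
proof (induction C)
  case empty
  then show ?case by simp
next
  case (insert x C)
  let ?S = "{(\<Sum>c\<in>C. a c *\<^sub>R c) |a. \<forall>c\<in>C. \<bar>a c\<bar> \<le> r c}"
  let ?T = "{(\<Sum>c\<in>insert x C. a c *\<^sub>R c) |a. \<forall>c\<in>insert x C. \<bar>a c\<bar> \<le> r c}"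
  have "?T = (\<lambda>(t, y). t *\<^sub>R x + y) ` ({-r x..r x} \<times> ?S)"
  proof (intro equalityI subsetI)
    fix z assume "z \<in> ?T"
    then obtain a where a: "z = (\<Sum>c\<in>insert x C. a c *\<^sub>R c)" "\<forall>c\<in>insert x C. \<bar>a c\<bar> \<le> r c"
      by blast
    have "(a x, \<Sum>c\<in>C. a c *\<^sub>R c) \<in> {-r x..r x} \<times> ?S"
      using a(2) by (auto simp: abs_le_iff)
    moreover have "z = (\<lambda>(t, y). t *\<^sub>R x + y) (a x, \<Sum>c\<in>C. a c *\<^sub>R c)"
      using a(1) insert.hyps by simp
    ultimately show "z \<in> (\<lambda>(t, y). t *\<^sub>R x + y) ` ({-r x..r x} \<times> ?S)"
      by blast
  next
    fix z assume "z \<in> (\<lambda>(t, y). t *\<^sub>R x + y) ` ({-r x..r x} \<times> ?S)"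
    then obtain t a where z: "z = t *\<^sub>R x + (\<Sum>c\<in>C. a c *\<^sub>R c)" "t \<in> {-r x..r x}"
      "\<forall>c\<in>C. \<bar>a c\<bar> \<le> r c"
      by auto
    have "(\<Sum>c\<in>C. (a(x := t)) c *\<^sub>R c) = (\<Sum>c\<in>C. a c *\<^sub>R c)"
      using insert.hyps by (intro sum.cong) auto
    then have "z = (\<Sum>c\<in>insert x C. (a(x := t)) c *\<^sub>R c)"
      using insert.hyps z(1) by simp
    moreover have "\<forall>c\<in>insert x C. \<bar>(a(x := t)) c\<bar> \<le> r c"
      using z(2,3) by auto
    ultimately show "z \<in> ?T" by blast
  qed
  moreover have "compact ((\<lambda>(t, y). t *\<^sub>R x + y) ` ({-r x..r x} \<times> ?S))"
    unfolding case_prod_beta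
    by (intro compact_continuous_image compact_Times insert.IH compact_Icc continuous_intros)
  ultimately show ?case by simp
qed

lemma has_dimension_compact_cball:
  fixes x :: "'v::real_inner"
  assumes "has_dimension TYPE('v) k"
  shows "compact (cball x r)"
proof -
  obtain B :: "'v set" where B: "finite B" "span B = UNIV"
    using assms unfolding has_dimension_def by blast
  obtain C where C: "finite C" "span C = (UNIV :: 'v set)" "pairwise orthogonal C"
    using basis_orthogonal[OF B(1)] B(2) by metis
  define S where "S = {(\<Sum>c\<in>C. a c *\<^sub>R c) |a. \<forall>c\<in>C. \<bar>a c\<bar> \<le> r / norm c}"
  have "y \<in> S" if "norm y \<le> r" for y
  proof -
    obtain u where u: "y = (\<Sum>c\<in>C. u c *\<^sub>R c)"
      using C(1,2) span_finite[OF C(1)] by (metis (no_types, lifting) UNIV_I rangeE)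
    \<comment> \<open>An orthogonal set may contain the zero vector, on whose coefficient \<open>y\<close> imposes no bound.\<close>
    define a where "a c = (if c = 0 then 0 else u c)" for c
    have y: "y = (\<Sum>c\<in>C. a c *\<^sub>R c)"
      unfolding u a_def by (intro sum.cong) auto
    have "\<bar>a c\<bar> \<le> r / norm c" if c: "c \<in> C" for c
    proof (cases "c = 0")
      case True
      then show ?thesis by (simp add: a_def)
    next
      case False
      have "y \<bullet> c = (\<Sum>b\<in>C. a b * (b \<bullet> c))"
        unfolding y by (simp add: inner_sum_left)
      also have "\<dots> = (\<Sum>b\<in>C. if b = c then a c * (c \<bullet> c) else 0)"
        using C(3) c by (intro sum.cong) (auto simp: pairwise_def orthogonal_def)
      also have "\<dots> = a c * (c \<bullet> c)"
        using C(1) c by simp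
      finally have "\<bar>a c\<bar> * (norm c * norm c) = \<bar>y \<bullet> c\<bar>"
        by (simp add: abs_mult dot_square_norm power2_eq_square)
      also have "\<dots> \<le> r * norm c"
        using Cauchy_Schwarz_ineq2[of y c] \<open>norm y \<le> r\<close>
        by (meson mult_right_mono norm_ge_zero order_trans)
      finally show ?thesis
        using False by (simp add: field_simps)
    qed
    then show ?thesis
      unfolding S_def y by blast
  qed
  then have "cball 0 r = S \<inter> cball 0 r"
    by auto
  moreover have "compact S"
    unfolding S_def by (rule compact_bounded_combinations[OF C(1)])
  ultimately have "compact (cball (0::'v) r)"
    by (metis closed_cball compact_Int_closed)
  then have "compact ((+) x ` cball 0 r)"
    by (rule compact_translation)
  moreover have "(+) x ` cball 0 r = cball x r"
    using image_add_cball[of x 0 r] by simp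
  ultimately show ?thesis by simp
qed

lemma has_dimension_compact_thickening:
  fixes K :: "'v::real_inner set"
  assumes "has_dimension TYPE('v) k" "compact K"
  shows "compact (\<Union>x\<in>K. cball x r)"
proof -
  have "(\<Union>x\<in>K. cball x r) = {x + y |x y. x \<in> K \<and> y \<in> cball 0 r}"
  proof (intro equalityI subsetI)
    fix z assume "z \<in> (\<Union>x\<in>K. cball x r)"
    then obtain x where "x \<in> K" "z \<in> cball x r" by blast
    then have "z = x + (z - x)" "z - x \<in> cball 0 r"
      by (auto simp: dist_norm norm_minus_commute)
    then show "z \<in> {x + y |x y. x \<in> K \<and> y \<in> cball 0 r}"
      using \<open>x \<in> K\<close> by blast
  qed (auto intro!: bexI simp: dist_norm norm_minus_commute)
  then show ?thesis
    using compact_sums[OF assms(2) has_dimension_compact_cball[OF assms(1)], of 0 r] by simp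
qed


section \<open>Charts and transition maps\<close>

lemma iterated_derivative_cong:
  assumes "open U" "\<And>x. x \<in> U \<Longrightarrow> f x = g x" "x \<in> U"
  shows "iterated_derivative vs f x = iterated_derivative vs g x"
  using assms(3)
proof (induction vs arbitrary: x)
  case Nil
  then show ?case using assms(2) by simp
next
  case (Cons v vs)
  have "(iterated_derivative vs f has_derivative D) (at x) \<longleftrightarrow>
      (iterated_derivative vs g has_derivative D) (at x)" for D
    by (intro iffI; erule has_derivative_transform_within_open[OF _ assms(1) Cons.prems])
      (simp_all add: Cons.IH)
  then show ?case
    by (simp add: frechet_derivative_def)
qed

lemma smooth_on_cong:
  assumes "smooth_on U f" "\<And>x. x \<in> U \<Longrightarrow> f x = g x"
  shows "smooth_on U g"
proof -
  have U: "open U" using assms(1) unfolding smooth_on_def by blast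
  have "iterated_derivative vs g differentiable (at x)" if "x \<in> U" for vs x
  proof -
    obtain D where "(iterated_derivative vs f has_derivative D) (at x)"
      using assms(1) \<open>x \<in> U\<close> unfolding smooth_on_def differentiable_def by blast
    then have "(iterated_derivative vs g has_derivative D) (at x)"
      by (rule has_derivative_transform_within_open[OF _ U \<open>x \<in> U\<close>])
        (rule iterated_derivative_cong[OF U assms(2)])
    then show ?thesis unfolding differentiable_def by blast
  qed
  then show ?thesis using U unfolding smooth_on_def by blast
qed

lemma is_chartD:
  assumes "is_chart c"
  shows "open (fst c)" "open (snd c ` fst c)" "continuous_on (fst c) (snd c)"
    "continuous_on (snd c ` fst c) (inv_into (fst c) (snd c))" "inj_on (snd c) (fst c)"
proof -
  obtain U \<phi> where c: "c = (U, \<phi>)" by (cases c)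
  have "open U" "open (\<phi> ` U)" and h: "homeomorphism U (\<phi> ` U) \<phi> (inv_into U \<phi>)"
    using assms unfolding is_chart_def c by auto
  then show "open (fst c)" "open (snd c ` fst c)" "continuous_on (fst c) (snd c)"
    "continuous_on (snd c ` fst c) (inv_into (fst c) (snd c))"
    by (auto simp: c homeomorphism_def)
  show "inj_on (snd c) (fst c)"
    using h unfolding c homeomorphism_def by (auto intro: inj_on_inverseI)
qed

lemma chart_image_open:
  assumes "is_chart c" "open W" "W \<subseteq> fst c"
  shows "open (snd c ` W)"
proof -
  have "snd c ` W = snd c ` fst c \<inter> inv_into (fst c) (snd c) -` W"
    using assms(3) is_chartD(5)[OF assms(1)] by (auto simp: inv_into_f_f subset_iff)
  then show ?thesis
    using continuous_open_preimage[OF is_chartD(4,2)[OF assms(1)] assms(2)] by simp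
qed

lemma smooth_structure_chart: "smooth_structure C \<Longrightarrow> c \<in> C \<Longrightarrow> is_chart c"
  unfolding smooth_structure_def by blast

abbreviation transition where
  "transition c c' \<equiv> snd c' \<circ> inv_into (fst c) (snd c)"

lemma transition_apply:
  assumes "is_chart c" "x \<in> fst c"
  shows "transition c c' (snd c x) = snd c' x"
  using is_chartD(5)[OF assms(1)] assms(2) by simp

lemma transition_smooth_diffeo:
  assumes C: "smooth_structure C" and c: "c \<in> C" "c' \<in> C"
  shows "smooth_diffeo_onto_image (snd c ` (fst c \<inter> fst c')) (transition c c')"
    (is "smooth_diffeo_onto_image ?U ?\<theta>")
proof -
  have ch: "is_chart c" "is_chart c'"
    using smooth_structure_chart[OF C] c by auto
  have sm: "smooth_on ?U ?\<theta>" "smooth_on (snd c' ` (fst c \<inter> fst c')) (transition c' c)"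
    using C c unfolding smooth_structure_def smoothly_compatible_def by (auto simp: case_prod_beta)
  have \<theta>: "?\<theta> (snd c x) = snd c' x" if "x \<in> fst c" for x
    using transition_apply[OF ch(1) that] .
  have inj: "inj_on ?\<theta> ?U"
  proof (rule inj_onI)
    fix y z assume "y \<in> ?U" "z \<in> ?U" "?\<theta> y = ?\<theta> z"
    then obtain x x' where x: "y = snd c x" "z = snd c x'" "x \<in> fst c \<inter> fst c'"
      "x' \<in> fst c \<inter> fst c'"
      by blast
    then have "snd c' x = snd c' x'"
      using \<theta>[of x] \<theta>[of x'] \<open>?\<theta> y = ?\<theta> z\<close> by (simp only: Int_iff)
    then have "x = x'"
      using inj_onD[OF is_chartD(5)[OF ch(2)]] x(3,4) by blast
    then show "y = z" using x by simp
  qed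
  have img: "?\<theta> ` ?U = snd c' ` (fst c \<inter> fst c')"
    unfolding image_image using \<theta> by (intro image_cong refl) blast
  have "transition c' c y = inv_into ?U ?\<theta> y" if y: "y \<in> snd c' ` (fst c \<inter> fst c')" for y
  proof -
    obtain x where x: "x \<in> fst c \<inter> fst c'" "y = snd c' x" using y by blast
    then have "y = ?\<theta> (snd c x)" using \<theta> by simp
    then have "inv_into ?U ?\<theta> y = snd c x"
      using inv_into_f_f[OF inj] x by (metis imageI)
    moreover have "transition c' c y = snd c x"
      unfolding x(2) using transition_apply[OF ch(2)] x(1) by blast
    ultimately show ?thesis by simp
  qed
  then have "smooth_on (?\<theta> ` ?U) (inv_into ?U ?\<theta>)"
    unfolding img using smooth_on_cong[OF sm(2)] by blast
  then show ?thesis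
    unfolding smooth_diffeo_onto_image_def using sm(1) inj by blast
qed

lemma local_rep_eq: "local_rep c c' f = snd c' \<circ> f \<circ> inv_into (fst c) (snd c)"
  by (cases c; cases c') simp

lemma local_rep_apply:
  assumes "is_chart c" "x \<in> fst c"
  shows "local_rep c c' f (snd c x) = snd c' (f x)"
  using is_chartD(5)[OF assms(1)] assms(2) by (simp add: local_rep_eq)

lemma chart_compact_image:
  assumes "is_chart c" "compact K" "K \<subseteq> fst c"
  shows "compact (snd c ` K)"
  using continuous_on_subset[OF is_chartD(3)[OF assms(1)] assms(3)] assms(2)
  by (rule compact_continuous_image)

lemma continuous_on_local_rep:
  assumes "is_chart c" "is_chart c'" "continuous_on UNIV f" "K \<subseteq> fst c" "f ` K \<subseteq> fst c'"
  shows "continuous_on (snd c ` K) (local_rep c c' f)"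
proof -
  have inv: "inv_into (fst c) (snd c) ` snd c ` K = K"
    using is_chartD(5)[OF assms(1)] assms(4) by (rule inv_into_image_cancel)
  then have inv': "(f \<circ> inv_into (fst c) (snd c)) ` snd c ` K = f ` K"
    by (simp only: image_comp[symmetric])
  have "continuous_on (snd c ` K) (inv_into (fst c) (snd c))"
    using is_chartD(4)[OF assms(1)] assms(4) by (meson continuous_on_subset image_mono)
  moreover have "continuous_on K f"
    using assms(3) continuous_on_subset by blast
  moreover have "continuous_on (f ` K) (snd c')"
    using is_chartD(3)[OF assms(2)] assms(5) continuous_on_subset by blast
  ultimately show ?thesis
    unfolding local_rep_eq comp_assoc
    by (intro continuous_on_compose) (simp_all only: inv inv')
qed


section \<open>The normed spaces of a family of semi-norms\<close>

lemma norm_le_F_norm: "x \<in> K \<Longrightarrow> ennreal (norm (u x)) \<le> F_norm F K u"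
  unfolding F_norm_def sup_norm_def by (intro add_increasing2 SUP_upper) simp_all

lemma sup_norm_le_iff: "sup_norm K u \<le> b \<longleftrightarrow> (\<forall>x\<in>K. ennreal (norm (u x)) \<le> b)"
  unfolding sup_norm_def by (rule SUP_le_iff)

lemma sup_norm_mono: "K' \<subseteq> K \<Longrightarrow> sup_norm K' u \<le> sup_norm K u"
  unfolding sup_norm_def by (rule SUP_subset_mono) auto

lemma sup_norm_cong: "(\<And>x. x \<in> K \<Longrightarrow> u x = v x) \<Longrightarrow> sup_norm K u = sup_norm K v"
  unfolding sup_norm_def by (intro SUP_cong) auto

text \<open>
  Convergence in norm determines the limit through the values at points. This is what identifies the
  limits that completeness provides on different compact sets and in different charts.
\<close>

lemma F_norm_tendsto_pointwise:
  assumes "((\<lambda>n. F_norm F K (\<lambda>y. l y - u n y)) \<longlongrightarrow> 0) G" "x \<in> K"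
  shows "((\<lambda>n. u n x) \<longlongrightarrow> l x) G"
proof (rule tendstoI)
  fix e :: real assume "e > 0"
  then have "\<forall>\<^sub>F n in G. F_norm F K (\<lambda>y. l y - u n y) < ennreal e"
    using order_tendstoD(2)[OF assms(1)] by simp
  then show "\<forall>\<^sub>F n in G. dist (u n x) (l x) < e"
  proof eventually_elim
    case (elim n)
    then have "ennreal (norm (l x - u n x)) < ennreal e"
      using norm_le_F_norm[OF assms(2), of "\<lambda>y. l y - u n y" F] by (rule le_less_trans[rotated])
    then show ?case by (simp add: dist_norm norm_minus_commute ennreal_less_iff)
  qed
qed

context
  fixes F :: "('v::real_inner, 'w::real_inner) seminorms"
  assumes F: "seminorm_family F"
begin

lemma F_cong:
  "compact K \<Longrightarrow> continuous_on K u \<Longrightarrow> (\<And>x. x \<in> K \<Longrightarrow> u x = v x) \<Longrightarrow> F K u = F K v"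
  using F[unfolded seminorm_family_def, rule_format, THEN conjunct1, rule_format] .

lemma F_triangle:
  "compact K \<Longrightarrow> continuous_on K u \<Longrightarrow> continuous_on K v \<Longrightarrow> F K (\<lambda>x. u x + v x) \<le> F K u + F K v"
  using F[unfolded seminorm_family_def, rule_format, THEN conjunct2, THEN conjunct1, rule_format] .

lemma F_scale:
  "compact K \<Longrightarrow> continuous_on K u \<Longrightarrow> F K (\<lambda>x. a *\<^sub>R u x) = ennreal \<bar>a\<bar> * F K u"
  using F[unfolded seminorm_family_def, rule_format, THEN conjunct2, THEN conjunct2, rule_format] .

lemma F_norm_cong:
  assumes "compact K" "continuous_on K u" "\<And>x. x \<in> K \<Longrightarrow> u x = v x"
  shows "F_norm F K u = F_norm F K v"
  using F_cong[OF assms] sup_norm_cong[of K u v] assms(3) by (simp add: F_norm_def)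

lemma CF_compact_cong:
  assumes "compact K" "u \<in> CF_compact F K" "\<And>x. x \<in> K \<Longrightarrow> u x = v x"
  shows "v \<in> CF_compact F K"
  using F_norm_cong[of K u v] assms continuous_on_cong[of K K u v]
  unfolding CF_compact_def by auto

lemma F_norm_minus_commute:
  assumes "compact K" "continuous_on K u" "continuous_on K v"
  shows "F_norm F K (\<lambda>x. u x - v x) = F_norm F K (\<lambda>x. v x - u x)"
proof -
  have "F K (\<lambda>x. (-1) *\<^sub>R (u x - v x)) = ennreal \<bar>-1\<bar> * F K (\<lambda>x. u x - v x)"
    by (intro F_scale continuous_intros assms)
  then show ?thesis
    by (simp add: F_norm_def sup_norm_def norm_minus_commute)
qed

lemma CF_compact_diff:
  assumes "compact K" "u \<in> CF_compact F K" "v \<in> CF_compact F K"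
  shows "(\<lambda>x. u x - v x) \<in> CF_compact F K"
proof -
  have c: "continuous_on K u" "continuous_on K v" "F_norm F K u < \<infinity>" "F_norm F K v < \<infinity>"
    using assms unfolding CF_compact_def by auto
  have "F_norm F K (\<lambda>x. u x - v x) \<le> F_norm F K (\<lambda>x. u x - 0) + F_norm F K (\<lambda>x. 0 - v x)"
    using F_norm_diff_triangle[OF F assms(1) c(1) continuous_on_const c(2), of 0] .
  also have "\<dots> = F_norm F K u + F_norm F K v"
    using F_norm_minus_commute[OF assms(1) continuous_on_const c(2), of 0] by simp
  finally show ?thesis
    using c unfolding CF_compact_def by (auto intro!: continuous_intros simp: order.strict_trans1)
qed

lemma F_norm_mono:
  assumes "monotonicity_property F" "compact K" "compact K'" "K' \<subseteq> K" "u \<in> CF_compact F K"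
  shows "F_norm F K' u \<le> F_norm F K u"
  using assms sup_norm_mono[OF assms(4), of u]
  unfolding monotonicity_property_def F_norm_def by (simp add: add_mono)

lemma CF_compact_mono:
  assumes "monotonicity_property F" "compact K" "compact K'" "K' \<subseteq> K" "u \<in> CF_compact F K"
  shows "u \<in> CF_compact F K'"
  using F_norm_mono[OF assms] assms continuous_on_subset
  unfolding CF_compact_def by (auto intro: le_less_trans)

end


section \<open>Convergence in charts\<close>

text \<open>
  The distance that the Whitney neighbourhoods use. It is only meaningful if \<open>f\<close> and \<open>g\<close> both map
  \<open>K\<close> into the domain of \<open>c'\<close>.
\<close>

definition chart_dist where
  "chart_dist F c c' K f g =
     F_norm F (snd c ` K) (\<lambda>y. local_rep c c' f y - local_rep c c' g y)"

locale whitney =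
  fixes F :: "('v::real_inner, 'w::real_inner) seminorms"
    and A :: "('a::{t2_space, second_countable_topology}, 'v) chart set"
    and B :: "('b::{t2_space, second_countable_topology}, 'w) chart set"
    and m d :: nat
  assumes dim_v: "has_dimension TYPE('v) m" and dim_w: "has_dimension TYPE('w) d"
    and A: "smooth_structure A" and B: "smooth_structure B"
    and F: "seminorm_family F" and banach: "banach_family F"
    and composition: "composition_property F" and gluing: "gluing_property F"
    and monotonicity: "monotonicity_property F"
begin

lemmas chart_A = smooth_structure_chart[OF A]
lemmas chart_B = smooth_structure_chart[OF B]

lemma CF_continuous: "f \<in> CF F A B \<Longrightarrow> continuous_on S f"
  unfolding CF_def using continuous_on_subset by blast

lemma CF_local_rep:
  "f \<in> CF F A B \<Longrightarrow> c \<in> A \<Longrightarrow> c' \<in> B \<Longrightarrow> compact K \<Longrightarrow> K \<subseteq> fst c \<Longrightarrow> f ` K \<subseteq> fst c'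
    \<Longrightarrow> local_rep c c' f \<in> CF_compact F (snd c ` K)"
  unfolding CF_def by blast

lemma continuous_local_rep:
  "c \<in> A \<Longrightarrow> c' \<in> B \<Longrightarrow> continuous_on UNIV f \<Longrightarrow> K \<subseteq> fst c \<Longrightarrow> f ` K \<subseteq> fst c'
    \<Longrightarrow> continuous_on (snd c ` K) (local_rep c c' f)"
  by (rule continuous_on_local_rep[OF chart_A chart_B])

lemma compact_image_A: "c \<in> A \<Longrightarrow> compact K \<Longrightarrow> K \<subseteq> fst c \<Longrightarrow> compact (snd c ` K)"
  by (rule chart_compact_image[OF chart_A])

lemma local_rep_A: "c \<in> A \<Longrightarrow> x \<in> fst c \<Longrightarrow> local_rep c c' f (snd c x) = snd c' (f x)"
  by (rule local_rep_apply[OF chart_A])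

lemma chart_dist_triangle:
  assumes "c \<in> A" "c' \<in> B" "compact K" "K \<subseteq> fst c"
    and "continuous_on UNIV f" "continuous_on UNIV g" "continuous_on UNIV h"
    and "f ` K \<subseteq> fst c'" "g ` K \<subseteq> fst c'" "h ` K \<subseteq> fst c'"
  shows "chart_dist F c c' K f h \<le> chart_dist F c c' K f g + chart_dist F c c' K g h"
  unfolding chart_dist_def using assms
  by (intro F_norm_diff_triangle[OF F] compact_image_A continuous_local_rep)

lemma chart_dist_commute:
  assumes "c \<in> A" "c' \<in> B" "compact K" "K \<subseteq> fst c"
    and "continuous_on UNIV f" "continuous_on UNIV g"
    and "f ` K \<subseteq> fst c'" "g ` K \<subseteq> fst c'"
  shows "chart_dist F c c' K f g = chart_dist F c c' K g f"
  unfolding chart_dist_def using assms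
  by (intro F_norm_minus_commute[OF F] compact_image_A continuous_local_rep)

lemma compact_thickening_in_open:
  fixes Z :: "'w set"
  assumes "compact Z" "open V" "Z \<subseteq> V"
  obtains e where "e > 0" "(\<Union>z\<in>Z. cball z e) \<subseteq> V" "compact (\<Union>z\<in>Z. cball z e)"
  by (rule compact_subset_open_imp_cball_epsilon_subset[OF assms])
    (rule that[OF _ _ has_dimension_compact_thickening[OF dim_w assms(1)]])

text \<open>
  The semi-norms of maps near \<open>G\<close> are at most \<open>F Z G + 1\<close>. For those with values in \<open>L\<close> the second
  half of the composition property therefore gives one common constant, so that changing coordinates
  is Lipschitz at \<open>G\<close>, which is what preserves convergence to \<open>G\<close>.
\<close>

lemma composition_near:
  fixes G :: "'v \<Rightarrow> 'w"
  assumes Z: "compact Z" "Z \<subseteq> S" and \<theta>: "smooth_diffeo_onto_image S \<theta>"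
    and \<tau>: "smooth_diffeo_onto_image T \<tau>" and G: "G \<in> CF_compact F Z"
    and L: "compact L" "L \<subseteq> T" "G ` Z \<subseteq> L"
  obtains \<delta> k where "\<delta> > 0"
    "\<And>H. H \<in> CF_compact F Z \<Longrightarrow> H ` Z \<subseteq> L \<Longrightarrow> F_norm F Z (\<lambda>x. G x - H x) < \<delta> \<Longrightarrow>
      F (\<theta> ` Z) (\<lambda>y. \<tau> (G (inv_into S \<theta> y)) - \<tau> (H (inv_into S \<theta> y)))
        \<le> ennreal k * F_norm F Z (\<lambda>x. G x - H x)"
proof -
  have Gfin: "F Z G < \<infinity>" and Gcont: "continuous_on Z G"
    using G unfolding CF_compact_def F_norm_def by (auto simp: ennreal_add_eq_top less_top)
  define R where "R = enn2real (F Z G) + 1"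
  have R: "ennreal R = F Z G + 1"
    unfolding R_def using Gfin by (simp add: ennreal_plus flip: ennreal_1)
  from composition[unfolded composition_property_def, rule_format, OF Z(1), THEN conjunct2]
  obtain \<kappa> :: "('w list \<Rightarrow> 'w \<Rightarrow> 'w) \<Rightarrow> ('v list \<Rightarrow> 'v \<Rightarrow> 'v) \<Rightarrow> 'w set \<Rightarrow> real \<Rightarrow> real"
    where \<kappa>: "\<forall>U \<phi> V \<psi> L R.
          smooth_diffeo_onto_image U \<phi> \<and> Z \<subseteq> U \<and>
          smooth_diffeo_onto_image V \<psi> \<and> compact L \<and> L \<subseteq> V \<longrightarrow>
          \<kappa> (derivatives_on V \<psi>) (derivatives_on U \<phi>) L R > 0 \<and>
          (\<forall>g\<in>CF_compact F Z. g ` Z \<subseteq> L \<longrightarrow>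
             (\<exists>\<delta>>0. \<forall>g'\<in>CF_compact F Z.
                g' ` Z \<subseteq> L \<and> F_norm F Z (\<lambda>x. g x - g' x) < \<delta> \<and>
                max (F Z g) (F Z g') \<le> ennreal R \<longrightarrow>
                F (\<phi> ` Z) (\<lambda>y. \<psi> (g (inv_into U \<phi> y)) - \<psi> (g' (inv_into U \<phi> y)))
                  \<le> ennreal (\<kappa> (derivatives_on V \<psi>) (derivatives_on U \<phi>) L R)
                     * F_norm F Z (\<lambda>x. g x - g' x)))"
    by (rule exE)
  define k where "k = \<kappa> (derivatives_on T \<tau>) (derivatives_on S \<theta>) L R"
  have "\<exists>\<delta>>0. \<forall>H\<in>CF_compact F Z.
      H ` Z \<subseteq> L \<and> F_norm F Z (\<lambda>x. G x - H x) < \<delta> \<and> max (F Z G) (F Z H) \<le> ennreal R \<longrightarrow>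
      F (\<theta> ` Z) (\<lambda>y. \<tau> (G (inv_into S \<theta> y)) - \<tau> (H (inv_into S \<theta> y)))
        \<le> ennreal k * F_norm F Z (\<lambda>x. G x - H x)"
    unfolding k_def using Z(2) \<theta> \<tau> L
    by (intro \<kappa>[THEN spec, THEN spec, THEN spec, THEN spec, THEN spec, THEN spec, THEN mp,
          THEN conjunct2, THEN bspec[OF _ G], THEN mp] conjI)
  then obtain \<delta> where \<delta>: "\<delta> > 0"
    "\<And>H. H \<in> CF_compact F Z \<Longrightarrow> H ` Z \<subseteq> L \<Longrightarrow> F_norm F Z (\<lambda>x. G x - H x) < \<delta> \<Longrightarrow>
      max (F Z G) (F Z H) \<le> ennreal R \<Longrightarrow>
      F (\<theta> ` Z) (\<lambda>y. \<tau> (G (inv_into S \<theta> y)) - \<tau> (H (inv_into S \<theta> y)))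
        \<le> ennreal k * F_norm F Z (\<lambda>x. G x - H x)"
    by (elim exE conjE) simp
  show thesis
  proof (rule that[of "min \<delta> 1" k])
    show "min \<delta> 1 > 0" using \<delta>(1) by simp
    fix H assume H: "H \<in> CF_compact F Z" "H ` Z \<subseteq> L" "F_norm F Z (\<lambda>x. G x - H x) < min \<delta> 1"
    have Hcont: "continuous_on Z H" using H(1) unfolding CF_compact_def by simp
    have "F Z (\<lambda>x. (G x - H x)) \<le> F_norm F Z (\<lambda>x. G x - H x)"
      unfolding F_norm_def by (simp add: add_increasing)
    then have "F Z (\<lambda>x. (G x - H x)) \<le> 1"
      using H(3) by (simp add: order_trans less_imp_le)
    moreover have "F Z (\<lambda>x. G x + (-1) *\<^sub>R (G x - H x)) \<le> F Z G + F Z (\<lambda>x. (-1) *\<^sub>R (G x - H x))"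
      by (intro F_triangle[OF F] Z Gcont Hcont continuous_intros)
    moreover have "F Z (\<lambda>x. (-1) *\<^sub>R (G x - H x)) = F Z (\<lambda>x. G x - H x)"
      using F_scale[OF F Z(1), of "\<lambda>x. G x - H x" "-1"] Gcont Hcont
      by (simp add: continuous_on_diff)
    ultimately have "F Z H \<le> F Z G + 1"
      by (simp add: add_left_mono order_trans)
    then have "max (F Z G) (F Z H) \<le> ennreal R"
      unfolding R by (simp add: add_increasing2)
    then show "F (\<theta> ` Z) (\<lambda>y. \<tau> (G (inv_into S \<theta> y)) - \<tau> (H (inv_into S \<theta> y)))
        \<le> ennreal k * F_norm F Z (\<lambda>x. G x - H x)"
      using \<delta>(2)[of H] H by simp
  qed
qed

text \<open>
  Convergence to \<open>g\<close> on \<open>K\<close>, read in one pair of charts, implies convergence read in any other pair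
  that can represent \<open>g\<close> on \<open>K\<close>. Uniform closeness in the first pair first forces the maps
  \<open>f n\<close> into the domain of the second target chart, since the values of \<open>g\<close> form a compact subset
  of the open overlap.
\<close>

lemma change_of_charts:
  assumes c: "c1 \<in> A" "c2 \<in> A" "c1' \<in> B" "c2' \<in> B"
    and K: "compact K" "K \<subseteq> fst c1 \<inter> fst c2"
    and f: "\<And>n. f n \<in> CF F A B" and fK: "\<forall>\<^sub>F n in sequentially. f n ` K \<subseteq> fst c1'"
    and g: "continuous_on UNIV g" "g ` K \<subseteq> fst c1' \<inter> fst c2'"
      "local_rep c1 c1' g \<in> CF_compact F (snd c1 ` K)"
    and lim: "(\<lambda>n. chart_dist F c1 c1' K g (f n)) \<longlonglongrightarrow> 0"
  shows "\<forall>\<^sub>F n in sequentially. f n ` K \<subseteq> fst c2'"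
    and "(\<lambda>n. chart_dist F c2 c2' K g (f n)) \<longlonglongrightarrow> 0"
proof -
  define Z where "Z = snd c1 ` K"
  define G where "G = local_rep c1 c1' g"
  define H where "H n = local_rep c1 c1' (f n)" for n
  define S where "S = snd c1 ` (fst c1 \<inter> fst c2)"
  define T where "T = snd c1' ` (fst c1' \<inter> fst c2')"
  define \<theta> where "\<theta> = transition c1 c2"
  define \<tau> where "\<tau> = transition c1' c2'"
  have Z: "compact Z" "Z \<subseteq> S"
    using K compact_image_A[OF c(1)] unfolding Z_def S_def by auto
  have \<theta>: "smooth_diffeo_onto_image S \<theta>"
    unfolding S_def \<theta>_def by (rule transition_smooth_diffeo[OF A c(1,2)])
  have \<tau>: "smooth_diffeo_onto_image T \<tau>"
    unfolding T_def \<tau>_def by (rule transition_smooth_diffeo[OF B c(3,4)])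
  have \<theta>_apply: "\<theta> (snd c1 x) = snd c2 x" if "x \<in> fst c1" for x
    unfolding \<theta>_def by (rule transition_apply[OF chart_A[OF c(1)] that])
  have \<tau>_apply: "\<tau> (snd c1' y) = snd c2' y" if "y \<in> fst c1'" for y
    unfolding \<tau>_def by (rule transition_apply[OF chart_B[OF c(3)] that])
  have G_apply: "G (snd c1 x) = snd c1' (g x)" if "x \<in> K" for x
    unfolding G_def using local_rep_A[OF c(1)] that K(2) by blast
  have H_apply: "H n (snd c1 x) = snd c1' (f n x)" if "x \<in> K" for x n
    unfolding H_def using local_rep_A[OF c(1)] that K(2) by blast
  have inv_\<theta>: "inv_into S \<theta> (snd c2 x) = snd c1 x" if "x \<in> K" for x
  proof -
    have "inj_on \<theta> S" "snd c1 x \<in> S"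
      using \<theta> Z(2) that unfolding smooth_diffeo_onto_image_def Z_def by auto
    then have "inv_into S \<theta> (\<theta> (snd c1 x)) = snd c1 x"
      by (rule inv_into_f_f)
    then show ?thesis using \<theta>_apply that K(2) by auto
  qed
  have G: "G \<in> CF_compact F Z" "continuous_on Z G"
    using g(3) unfolding G_def Z_def CF_compact_def by auto
  have "open T" unfolding T_def
    by (intro chart_image_open chart_B c open_Int is_chartD(1)) simp
  have "G ` Z \<subseteq> T"
  proof
    fix y assume "y \<in> G ` Z"
    then obtain x where "x \<in> K" "y = G (snd c1 x)"
      unfolding Z_def by blast
    then show "y \<in> T"
      using G_apply[of x] g(2) unfolding T_def by blast
  qed
  obtain e where e: "e > 0" "(\<Union>z\<in>G ` Z. cball z e) \<subseteq> T"
    "compact (\<Union>z\<in>G ` Z. cball z e)"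
    by (rule compact_thickening_in_open[OF compact_continuous_image[OF G(2) Z(1)]
          \<open>open T\<close> \<open>G ` Z \<subseteq> T\<close>])
  define L where "L = (\<Union>z\<in>G ` Z. cball z e)"
  have L: "compact L" "L \<subseteq> T" "G ` Z \<subseteq> L"
    using e unfolding L_def by auto
  have lim': "(\<lambda>n. F_norm F Z (\<lambda>y. G y - H n y)) \<longlonglongrightarrow> 0"
    using lim unfolding chart_dist_def G_def H_def Z_def .
  have close: "\<forall>\<^sub>F n in sequentially. \<forall>z\<in>Z. norm (G z - H n z) < r" if "r > 0" for r
  proof -
    have "\<forall>\<^sub>F n in sequentially. F_norm F Z (\<lambda>y. G y - H n y) < ennreal r"
      using order_tendstoD(2)[OF lim', of "ennreal r"] that by simp
    then show ?thesis
    proof (rule eventually_mono, intro ballI)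
      fix n z assume "F_norm F Z (\<lambda>y. G y - H n y) < ennreal r" "z \<in> Z"
      then have "ennreal (norm (G z - H n z)) < ennreal r"
        using le_less_trans[OF norm_le_F_norm[of z Z "\<lambda>y. G y - H n y" F]] by blast
      then show "norm (G z - H n z) < r"
        by (simp add: ennreal_less_iff)
    qed
  qed
  have HL: "\<forall>\<^sub>F n in sequentially. H n ` Z \<subseteq> L"
    using close[OF e(1)]
    by eventually_elim (force simp: L_def dist_norm)
  have fK2: "\<forall>\<^sub>F n in sequentially. f n ` K \<subseteq> fst c1' \<inter> fst c2'"
    using HL fK
  proof eventually_elim
    case (elim n)
    show ?case
    proof
      fix y assume "y \<in> f n ` K"
      then obtain x where x: "x \<in> K" "y = f n x" by blast
      then have y: "y \<in> fst c1'" "snd c1' y \<in> T"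
        using elim H_apply[OF x(1), of n, symmetric] L(2) unfolding Z_def by auto
      then obtain y' where "y' \<in> fst c1' \<inter> fst c2'" "snd c1' y = snd c1' y'"
        unfolding T_def by blast
      then show "y \<in> fst c1' \<inter> fst c2'"
        using inj_onD[OF is_chartD(5)[OF chart_B[OF c(3)]]] y(1) by blast
    qed
  qed
  then show "\<forall>\<^sub>F n in sequentially. f n ` K \<subseteq> fst c2'"
    by eventually_elim blast
  have HCF: "\<forall>\<^sub>F n in sequentially. H n \<in> CF_compact F Z"
    using fK
    by eventually_elim (use CF_local_rep[OF f c(1,3) K(1)] K(2) in \<open>auto simp: H_def Z_def\<close>)
  \<comment> \<open>The composition property controls only the semi-norm; the sup-norm is controlled by uniform
    continuity of the transition map on the compact set \<open>L\<close>.\<close>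
  have sup_lim: "(\<lambda>n. sup_norm (snd c2 ` K) (\<lambda>y. local_rep c2 c2' g y - local_rep c2 c2' (f n) y))
      \<longlonglongrightarrow> 0"
  proof (rule tendsto_zero_ennreal)
    fix r :: real assume "r > 0"
    have "continuous_on T \<tau>"
      using \<tau> unfolding smooth_diffeo_onto_image_def smooth_on_def
      by (auto intro!: continuous_at_imp_continuous_on differentiable_imp_continuous_within
          dest!: spec[of _ "[]"])
    then have "uniformly_continuous_on L \<tau>"
      using compact_uniformly_continuous[OF continuous_on_subset[OF _ L(2)] L(1)] by blast
    then obtain s where s: "s > 0" "\<And>y z. y \<in> L \<Longrightarrow> z \<in> L \<Longrightarrow> dist z y < s \<Longrightarrow> dist (\<tau> z) (\<tau> y) < r / 2"
      using \<open>r > 0\<close> unfolding uniformly_continuous_on_def by (meson half_gt_zero)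
    show "\<forall>\<^sub>F n in sequentially.
        sup_norm (snd c2 ` K) (\<lambda>y. local_rep c2 c2' g y - local_rep c2 c2' (f n) y) < ennreal r"
      using close[OF s(1)] HL fK
    proof eventually_elim
      case (elim n)
      have "norm (local_rep c2 c2' g (snd c2 x) - local_rep c2 c2' (f n) (snd c2 x)) \<le> r / 2"
        if x: "x \<in> K" for x
      proof -
        have "snd c1 x \<in> Z" using x unfolding Z_def by blast
        then have "dist (\<tau> (G (snd c1 x))) (\<tau> (H n (snd c1 x))) < r / 2"
          using elim(1,2) L(3) by (intro s(2)) (auto simp: dist_norm)
        moreover have "g x \<in> fst c1'" "f n x \<in> fst c1'" "x \<in> fst c2"
          using x g(2) elim(3) K(2) by auto
        ultimately show ?thesis
          using x by (simp add: G_apply H_apply \<tau>_apply local_rep_A[OF c(2)] dist_norm)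
      qed
      then have "sup_norm (snd c2 ` K) (\<lambda>y. local_rep c2 c2' g y - local_rep c2 c2' (f n) y)
          \<le> ennreal (r / 2)"
        unfolding sup_norm_le_iff by (auto intro: ennreal_leI)
      also have "\<dots> < ennreal r"
        using \<open>r > 0\<close> by (simp add: ennreal_less_iff)
      finally show ?case .
    qed
  qed
  obtain \<delta> k where k: "\<delta> > 0" "\<And>H. H \<in> CF_compact F Z \<Longrightarrow> H ` Z \<subseteq> L \<Longrightarrow>
      F_norm F Z (\<lambda>x. G x - H x) < \<delta> \<Longrightarrow>
      F (\<theta> ` Z) (\<lambda>y. \<tau> (G (inv_into S \<theta> y)) - \<tau> (H (inv_into S \<theta> y)))
        \<le> ennreal k * F_norm F Z (\<lambda>x. G x - H x)"
    by (rule composition_near[OF Z \<theta> \<tau> G(1) L]) (rule that)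
  have img: "\<theta> ` Z = snd c2 ` K"
    unfolding Z_def image_image using \<theta>_apply K(2) by (intro image_cong refl) blast
  have F_le: "\<forall>\<^sub>F n in sequentially.
      F (snd c2 ` K) (\<lambda>y. local_rep c2 c2' g y - local_rep c2 c2' (f n) y)
        \<le> ennreal k * F_norm F Z (\<lambda>y. G y - H n y)"
    using HCF HL fK2 order_tendstoD(2)[OF lim' k(1)]
  proof eventually_elim
    case (elim n)
    have "F (snd c2 ` K) (\<lambda>y. local_rep c2 c2' g y - local_rep c2 c2' (f n) y)
        = F (snd c2 ` K) (\<lambda>y. \<tau> (G (inv_into S \<theta> y)) - \<tau> (H n (inv_into S \<theta> y)))"
    proof (rule F_cong[OF F])
      show "compact (snd c2 ` K)"
        using compact_image_A[OF c(2)] K by blast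
      show "continuous_on (snd c2 ` K) (\<lambda>y. local_rep c2 c2' g y - local_rep c2 c2' (f n) y)"
        using c K g elim(3) CF_continuous[OF f]
        by (intro continuous_on_diff continuous_local_rep) auto
      fix y assume "y \<in> snd c2 ` K"
      then obtain x where x: "x \<in> K" "y = snd c2 x" by blast
      moreover have "g x \<in> fst c1'" "f n x \<in> fst c1'" "x \<in> fst c2"
        using x g(2) elim(3) K(2) by auto
      ultimately show "local_rep c2 c2' g y - local_rep c2 c2' (f n) y
          = \<tau> (G (inv_into S \<theta> y)) - \<tau> (H n (inv_into S \<theta> y))"
        by (simp add: inv_\<theta> G_apply H_apply \<tau>_apply local_rep_A[OF c(2)])
    qed
    also have "\<dots> \<le> ennreal k * F_norm F Z (\<lambda>y. G y - H n y)"
      using k(2)[of "H n"] elim unfolding img by blast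
    finally show ?case .
  qed
  have "(\<lambda>n. ennreal k * F_norm F Z (\<lambda>y. G y - H n y)) \<longlonglongrightarrow> 0"
    using ennreal_tendsto_cmult[OF ennreal_less_top lim', of k] by simp
  then have "(\<lambda>n. F (snd c2 ` K) (\<lambda>y. local_rep c2 c2' g y - local_rep c2 c2' (f n) y)) \<longlonglongrightarrow> 0"
    by (rule tendsto_sandwich[OF _ F_le tendsto_const, rotated]) simp
  from tendsto_add[OF sup_lim this]
  show "(\<lambda>n. chart_dist F c2 c2' K g (f n)) \<longlonglongrightarrow> 0"
    unfolding chart_dist_def F_norm_def by simp
qed


lemma complete_in_chart:
  assumes c: "c \<in> A" "c' \<in> B" and K: "compact K" "K \<subseteq> fst c"
    and f: "\<And>n. f n \<in> CF F A B" and fK: "\<forall>\<^sub>F n in sequentially. f n ` K \<subseteq> fst c'"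
    and Cauchy: "\<And>e. e > 0 \<Longrightarrow> \<exists>n0. \<forall>i\<ge>n0. \<forall>j\<ge>n0. chart_dist F c c' K (f i) (f j) < e"
  obtains l where "l \<in> CF_compact F (snd c ` K)"
    "(\<lambda>n. F_norm F (snd c ` K) (\<lambda>y. l y - local_rep c c' (f n) y)) \<longlonglongrightarrow> 0"
proof -
  define Z where "Z = snd c ` K"
  obtain N where N: "\<And>n. n \<ge> N \<Longrightarrow> f n ` K \<subseteq> fst c'"
    using fK unfolding eventually_sequentially by blast
  define u where "u n = local_rep c c' (f (n + N))" for n
  have Z: "compact Z"
    unfolding Z_def by (rule compact_image_A[OF c(1) K])
  have u: "\<forall>n. u n \<in> CF_compact F Z"
    unfolding u_def Z_def using CF_local_rep[OF f c K] N by simp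
  have "\<forall>e>0. \<exists>n0. \<forall>i\<ge>n0. \<forall>j\<ge>n0. F_norm F Z (\<lambda>x. u i x - u j x) < e"
  proof (intro allI impI)
    fix e :: ennreal assume "e > 0"
    then obtain n0 where "\<forall>i\<ge>n0. \<forall>j\<ge>n0. chart_dist F c c' K (f i) (f j) < e"
      using Cauchy by blast
    then show "\<exists>n0. \<forall>i\<ge>n0. \<forall>j\<ge>n0. F_norm F Z (\<lambda>x. u i x - u j x) < e"
      unfolding chart_dist_def Z_def[symmetric] u_def by (metis trans_le_add1)
  qed
  then obtain l where l: "l \<in> CF_compact F Z" "(\<lambda>n. F_norm F Z (\<lambda>x. u n x - l x)) \<longlonglongrightarrow> 0"
    using banach[unfolded banach_family_def, THEN spec, THEN mp, OF Z, THEN spec, of u] u by blast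
  have "F_norm F Z (\<lambda>x. u n x - l x) = F_norm F Z (\<lambda>x. l x - u n x)" for n
    using u l(1) by (intro F_norm_minus_commute[OF F Z]) (auto simp: CF_compact_def)
  then have "(\<lambda>n. F_norm F Z (\<lambda>x. l x - local_rep c c' (f (n + N)) x)) \<longlonglongrightarrow> 0"
    using l(2) unfolding u_def by simp
  then have "(\<lambda>n. F_norm F Z (\<lambda>x. l x - local_rep c c' (f n) x)) \<longlonglongrightarrow> 0"
    by (rule LIMSEQ_offset)
  then show thesis
    using that l(1) unfolding Z_def by blast
qed

text \<open>
  Convergence on finitely many compact pieces implies convergence on their union, including the
  finiteness of the norm of the limit there. The gluing property presupposes a finite norm on the union.
  This is known for the differences \<open>f i - f j\<close>, but not for the limit \<open>g\<close>. So gluing is used to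
  show that the \<open>f n\<close> form a Cauchy sequence on the union, and completeness then produces a limit of
  finite norm, which must be \<open>g\<close>.
\<close>

lemma glue_convergence:
  assumes c: "c \<in> A" "c' \<in> B" and \<P>: "finite \<P>" "\<And>P. P \<in> \<P> \<Longrightarrow> compact P" "\<Union>\<P> \<subseteq> fst c"
    and f: "\<And>n. f n \<in> CF F A B" and g: "continuous_on UNIV g" "g ` \<Union>\<P> \<subseteq> fst c'"
    and fP: "\<And>P. P \<in> \<P> \<Longrightarrow> \<forall>\<^sub>F n in sequentially. f n ` P \<subseteq> fst c'"
    and lim: "\<And>P. P \<in> \<P> \<Longrightarrow> (\<lambda>n. chart_dist F c c' P g (f n)) \<longlonglongrightarrow> 0"
  shows "local_rep c c' g \<in> CF_compact F (snd c ` \<Union>\<P>)"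
    and "(\<lambda>n. chart_dist F c c' (\<Union>\<P>) g (f n)) \<longlonglongrightarrow> 0"
proof -
  define Z where "Z = snd c ` \<Union>\<P>"
  have K: "compact (\<Union>\<P>)"
    using \<P>(1,2) by (rule compact_Union)
  have Z: "compact Z"
    unfolding Z_def by (rule compact_image_A[OF c(1) K \<P>(3)])
  have "\<forall>\<^sub>F n in sequentially. \<forall>P\<in>\<P>. f n ` P \<subseteq> fst c'"
    using fP by (intro eventually_ball_finite \<P>(1)) blast
  then have fK: "\<forall>\<^sub>F n in sequentially. f n ` \<Union>\<P> \<subseteq> fst c'"
    by eventually_elim blast
  then obtain N where "\<forall>n\<ge>N. f n ` \<Union>\<P> \<subseteq> fst c'"
    by (rule eventually_sequentially[THEN iffD1, THEN exE])
  then have N: "\<And>n. n \<ge> N \<Longrightarrow> f n ` \<Union>\<P> \<subseteq> fst c'"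
    by simp
  define s where "s n = (\<Sum>P\<in>\<P>. chart_dist F c c' P g (f n))" for n
  have "s \<longlonglongrightarrow> (\<Sum>P\<in>\<P>. 0)"
    unfolding s_def by (intro tendsto_sum lim)
  then have s: "s \<longlonglongrightarrow> 0" by simp
  obtain C :: real where C: "C > 0"
    "\<And>u. u \<in> CF_compact F Z \<Longrightarrow> F Z u \<le> ennreal C * (\<Sum>P\<in>\<P>. F (snd c ` P) u)"
  proof -
    define \<K> where "\<K> = (`) (snd c) ` \<P>"
    have "compact K" if "K \<in> \<K>" for K
      using that \<P>(2,3) compact_image_A[OF c(1)] unfolding \<K>_def by blast
    then have "finite \<K> \<and> (\<forall>K\<in>\<K>. compact K)"
      using \<P>(1) unfolding \<K>_def by blast
    from gluing[unfolded gluing_property_def, THEN spec, THEN mp, OF this]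
    obtain C :: real where C: "C > 0"
      "\<forall>u\<in>CF_compact F (\<Union>\<K>). F (\<Union>\<K>) u \<le> ennreal C * (\<Sum>K\<in>\<K>. F K u)"
      by (elim exE conjE)
    have Z_eq: "\<Union>\<K> = Z"
      unfolding Z_def \<K>_def by blast
    show thesis
    proof (rule that[OF C(1)])
      fix u assume "u \<in> CF_compact F Z"
      then have "F Z u \<le> ennreal C * (\<Sum>K\<in>\<K>. F K u)"
        using C(2) unfolding Z_eq by (rule bspec[rotated])
      also have "(\<Sum>K\<in>\<K>. F K u) \<le> (\<Sum>P\<in>\<P>. F (snd c ` P) u)"
        using sum_image_le[OF \<P>(1), of "\<lambda>K. F K u" "(`) (snd c)"]
        unfolding \<K>_def by (simp add: o_def)
      finally show "F Z u \<le> ennreal C * (\<Sum>P\<in>\<P>. F (snd c ` P) u)"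
        by (simp add: mult_left_mono)
    qed
  qed
  \<comment> \<open>The first summand accounts for the sup-norm, the second for the semi-norm.\<close>
  define t where "t n = s n + ennreal C * s n" for n
  have t: "t \<longlonglongrightarrow> 0"
    unfolding t_def using tendsto_add[OF s ennreal_tendsto_cmult[OF ennreal_less_top s, of C]] by simp
  have t_bound: "chart_dist F c c' (\<Union>\<P>) (f i) (f j) \<le> t i + t j" if ij: "i \<ge> N" "j \<ge> N" for i j
  proof -
    define u where "u y = local_rep c c' (f i) y - local_rep c c' (f j) y" for y
    have u: "u \<in> CF_compact F Z"
      unfolding u_def Z_def
      using CF_local_rep[OF f c K \<P>(3)] N ij Z by (intro CF_compact_diff[OF F]) (auto simp: Z_def)
    have piece: "F_norm F (snd c ` P) u
        \<le> chart_dist F c c' P g (f i) + chart_dist F c c' P g (f j)" if P: "P \<in> \<P>" for P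
    proof -
      have fij: "f i ` P \<subseteq> fst c'" "f j ` P \<subseteq> fst c'" "g ` P \<subseteq> fst c'" "P \<subseteq> fst c"
        using N[OF ij(1)] N[OF ij(2)] g(2) \<P>(3) P by blast+
      have "chart_dist F c c' P (f i) (f j) \<le> chart_dist F c c' P (f i) g + chart_dist F c c' P g (f j)"
        by (intro chart_dist_triangle c \<P>(2) P fij CF_continuous f g)
      also have "chart_dist F c c' P (f i) g = chart_dist F c c' P g (f i)"
        by (intro chart_dist_commute c \<P>(2) P fij CF_continuous f g)
      finally show ?thesis
        unfolding chart_dist_def u_def .
    qed
    have le_s: "(\<Sum>P\<in>\<P>. F_norm F (snd c ` P) u) \<le> s i + s j"
      unfolding s_def sum.distrib[symmetric] by (rule sum_mono[OF piece])
    have "sup_norm Z u \<le> s i + s j"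
      unfolding sup_norm_le_iff
    proof
      fix y assume "y \<in> Z"
      then obtain P where P: "P \<in> \<P>" "y \<in> snd c ` P" unfolding Z_def by blast
      have "ennreal (norm (u y)) \<le> F_norm F (snd c ` P) u"
        by (rule norm_le_F_norm[OF P(2)])
      also have "\<dots> \<le> (\<Sum>P\<in>\<P>. F_norm F (snd c ` P) u)"
        using \<P>(1) P(1) by (intro member_le_sum) auto
      finally show "ennreal (norm (u y)) \<le> s i + s j"
        using le_s by (rule order_trans)
    qed
    moreover have "F Z u \<le> ennreal C * (s i + s j)"
    proof -
      have "(\<Sum>P\<in>\<P>. F (snd c ` P) u) \<le> (\<Sum>P\<in>\<P>. F_norm F (snd c ` P) u)"
        unfolding F_norm_def by (intro sum_mono) (simp add: add_increasing)
      then show ?thesis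
        by (intro order_trans[OF C(2)[OF u]] mult_left_mono order_trans[OF _ le_s]) simp_all
    qed
    ultimately have "F_norm F Z u \<le> (s i + s j) + ennreal C * (s i + s j)"
      unfolding F_norm_def by (rule add_mono)
    also have "\<dots> = t i + t j"
      unfolding t_def by (simp add: distrib_left ac_simps)
    finally show ?thesis
      unfolding chart_dist_def u_def Z_def .
  qed
  have Cauchy: "\<exists>n0. \<forall>i\<ge>n0. \<forall>j\<ge>n0. chart_dist F c c' (\<Union>\<P>) (f i) (f j) < e" if pos: "e > 0" for e
  proof -
    obtain e' where e': "0 < e'" "e' < e" using dense[OF pos] by blast
    define r where "r = enn2real e'"
    have "e' < top"
      by (rule less_le_trans[OF e'(2) top_greatest])
    then have r: "e' = ennreal r" "r > 0"
      unfolding r_def using e'(1) by (simp_all add: enn2real_positive_iff)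
    have "\<forall>\<^sub>F n in sequentially. t n < ennreal (r / 2)"
      using order_tendstoD(2)[OF t, of "ennreal (r / 2)"] r(2) by simp
    then obtain M where M: "\<forall>n\<ge>M. t n < ennreal (r / 2)"
      by (rule eventually_sequentially[THEN iffD1, THEN exE])
    have "chart_dist F c c' (\<Union>\<P>) (f i) (f j) < e" if "i \<ge> max M N" "j \<ge> max M N" for i j
    proof -
      have "chart_dist F c c' (\<Union>\<P>) (f i) (f j) \<le> t i + t j"
        using t_bound that by simp
      also have "\<dots> \<le> ennreal (r / 2) + ennreal (r / 2)"
        using M that by (intro add_mono less_imp_le) simp_all
      also have "\<dots> = e'"
        using r by (simp flip: ennreal_plus)
      finally show ?thesis using e'(2) by (rule le_less_trans)
    qed
    then show ?thesis by blast
  qed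
  obtain l where l: "l \<in> CF_compact F Z"
    "(\<lambda>n. F_norm F Z (\<lambda>y. l y - local_rep c c' (f n) y)) \<longlonglongrightarrow> 0"
    unfolding Z_def by (rule complete_in_chart[OF c K \<P>(3) f fK Cauchy])
  have l_eq: "l y = local_rep c c' g y" if y: "y \<in> Z" for y
  proof -
    obtain P where P: "P \<in> \<P>" "y \<in> snd c ` P" using y unfolding Z_def by blast
    have "(\<lambda>n. local_rep c c' (f n) y) \<longlonglongrightarrow> local_rep c c' g y"
      using F_norm_tendsto_pointwise[OF lim[OF P(1), unfolded chart_dist_def] P(2)] .
    with F_norm_tendsto_pointwise[OF l(2) y] show ?thesis
      by (rule LIMSEQ_unique)
  qed
  show "local_rep c c' g \<in> CF_compact F (snd c ` \<Union>\<P>)"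
    using CF_compact_cong[OF F Z l(1) l_eq] unfolding Z_def .
  have "\<forall>\<^sub>F n in sequentially. F_norm F Z (\<lambda>y. l y - local_rep c c' (f n) y)
      = chart_dist F c c' (\<Union>\<P>) g (f n)"
    using fK
  proof eventually_elim
    case (elim n)
    have "continuous_on Z l" "continuous_on Z (local_rep c c' (f n))"
      using l(1) CF_local_rep[OF f c K \<P>(3) elim] unfolding CF_compact_def Z_def by auto
    then show ?case
      unfolding chart_dist_def Z_def[symmetric]
      by (intro F_norm_cong[OF F Z] continuous_intros) (simp_all add: l_eq)
  qed
  from tendsto_cong[OF this] l(2)
  show "(\<lambda>n. chart_dist F c c' (\<Union>\<P>) g (f n)) \<longlonglongrightarrow> 0" by simp
qed

text \<open>
  A sequence that is Cauchy on pieces whose interiors cover \<open>M\<close> has a limit in \<open>C\<^sup>F(M, N)\<close>.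
  Completeness yields a limit in each piece, confinement to a compact set keeps that limit inside the
  target chart, and the Hausdorff property of \<open>N\<close> makes the local limits agree. The limit has finite
  norm in every other pair of charts because a compact set there splits into finitely many parts, each
  within one piece: on each part one changes charts, and the parts are then glued.
\<close>

lemma weak_limit_exists:
  fixes f :: "nat \<Rightarrow> 'a \<Rightarrow> 'b"
  assumes f: "\<And>n. f n \<in> CF F A B"
    and D: "\<And>c c' K. (c, c', K) \<in> D \<Longrightarrow> c \<in> A \<and> c' \<in> B \<and> compact K \<and> K \<subseteq> fst c"
    and cover: "\<And>x. \<exists>c c' K. (c, c', K) \<in> D \<and> x \<in> interior K"
    and confined: "\<And>c c' K. (c, c', K) \<in> D \<Longrightarrow> \<exists>L. compact L \<and> L \<subseteq> snd c' ` fst c' \<and>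
      (\<forall>\<^sub>F n in sequentially. f n ` K \<subseteq> fst c' \<and> snd c' ` f n ` K \<subseteq> L)"
    and Cauchy: "\<And>c c' K e. (c, c', K) \<in> D \<Longrightarrow> e > 0 \<Longrightarrow>
      \<exists>n0. \<forall>i\<ge>n0. \<forall>j\<ge>n0. chart_dist F c c' K (f i) (f j) < e"
  obtains g where "g \<in> CF F A B" "\<And>c c' K. (c, c', K) \<in> D \<Longrightarrow> g ` K \<subseteq> fst c'"
    "\<And>c c' K. (c, c', K) \<in> D \<Longrightarrow> (\<lambda>n. chart_dist F c c' K g (f n)) \<longlonglongrightarrow> 0"
proof -
  define g where "g x = lim (\<lambda>n. f n x)" for x
  have local: "g ` K \<subseteq> fst c' \<and> continuous_on K g \<and> local_rep c c' g \<in> CF_compact F (snd c ` K) \<and>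
      (\<lambda>n. chart_dist F c c' K g (f n)) \<longlonglongrightarrow> 0 \<and> (\<forall>\<^sub>F n in sequentially. f n ` K \<subseteq> fst c')"
    if d: "(c, c', K) \<in> D" for c c' K
  proof -
    have c: "c \<in> A" "c' \<in> B" and K: "compact K" "K \<subseteq> fst c"
      using D[OF d] by auto
    obtain L where L: "compact L" "L \<subseteq> snd c' ` fst c'"
      and fL: "\<forall>\<^sub>F n in sequentially. f n ` K \<subseteq> fst c' \<and> snd c' ` f n ` K \<subseteq> L"
      using confined[OF d] by blast
    have fK: "\<forall>\<^sub>F n in sequentially. f n ` K \<subseteq> fst c'"
      using fL by eventually_elim blast
    have Z: "compact (snd c ` K)" by (rule compact_image_A[OF c(1) K])
    obtain l where l: "l \<in> CF_compact F (snd c ` K)"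
      "(\<lambda>n. F_norm F (snd c ` K) (\<lambda>y. l y - local_rep c c' (f n) y)) \<longlonglongrightarrow> 0"
      by (rule complete_in_chart[OF c K f fK Cauchy[OF d]])
    let ?inv = "inv_into (fst c') (snd c')"
    have lL: "l (snd c x) \<in> L" and g_eq: "g x = ?inv (l (snd c x))" if x: "x \<in> K" for x
    proof -
      have "(\<lambda>n. local_rep c c' (f n) (snd c x)) \<longlonglongrightarrow> l (snd c x)"
        using F_norm_tendsto_pointwise[OF l(2)] x by blast
      then have lim: "(\<lambda>n. snd c' (f n x)) \<longlonglongrightarrow> l (snd c x)"
        by (simp add: local_rep_A[OF c(1) subsetD[OF K(2) x]])
      have "\<forall>\<^sub>F n in sequentially. snd c' (f n x) \<in> L"
        using fL by eventually_elim (use x in blast)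
      then show lL: "l (snd c x) \<in> L"
        by (rule Lim_in_closed_set[OF compact_imp_closed[OF L(1)] _ sequentially_bot lim])
      have "isCont ?inv (l (snd c x))"
        using is_chartD(4,2)[OF chart_B[OF c(2)]] lL L(2) continuous_on_eq_continuous_at by blast
      then have "(\<lambda>n. ?inv (snd c' (f n x))) \<longlonglongrightarrow> ?inv (l (snd c x))"
        using lim by (rule isCont_tendsto_compose)
      moreover have "\<forall>\<^sub>F n in sequentially. ?inv (snd c' (f n x)) = f n x"
        using fK
        by eventually_elim (use x in \<open>blast intro: inv_into_f_f[OF is_chartD(5)[OF chart_B[OF c(2)]]]\<close>)
      ultimately have "(\<lambda>n. f n x) \<longlonglongrightarrow> ?inv (l (snd c x))"
        by (simp add: tendsto_cong)
      then show "g x = ?inv (l (snd c x))"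
        unfolding g_def by (rule limI)
    qed
    have g_in: "g x \<in> fst c'" and g_l: "snd c' (g x) = l (snd c x)" if x: "x \<in> K" for x
    proof -
      have "l (snd c x) \<in> snd c' ` fst c'" using lL[OF x] L(2) by blast
      then show "g x \<in> fst c'" "snd c' (g x) = l (snd c x)"
        unfolding g_eq[OF x] by (rule inv_into_into, rule f_inv_into_f)
    qed
    have "continuous_on K (\<lambda>x. ?inv (l (snd c x)))"
    proof (rule continuous_on_compose2[OF is_chartD(4)[OF chart_B[OF c(2)]]])
      show "continuous_on K (\<lambda>x. l (snd c x))"
      proof (rule continuous_on_compose2[of "snd c ` K" l])
        show "continuous_on (snd c ` K) l" using l(1) unfolding CF_compact_def by blast
        show "continuous_on K (snd c)"
          using is_chartD(3)[OF chart_A[OF c(1)]] K(2) by (rule continuous_on_subset)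
      qed simp
      show "(\<lambda>x. l (snd c x)) ` K \<subseteq> snd c' ` fst c'" using lL L(2) by blast
    qed
    then have cont: "continuous_on K g"
      by (rule continuous_on_eq) (simp add: g_eq)
    have l_eq: "l y = local_rep c c' g y" if "y \<in> snd c ` K" for y
    proof -
      obtain x where x: "x \<in> K" "y = snd c x" using \<open>y \<in> snd c ` K\<close> by blast
      show ?thesis
        unfolding x(2) by (simp only: local_rep_A[OF c(1) subsetD[OF K(2) x(1)]] g_l[OF x(1)])
    qed
    have "\<forall>\<^sub>F n in sequentially. F_norm F (snd c ` K) (\<lambda>y. l y - local_rep c c' (f n) y)
        = chart_dist F c c' K g (f n)"
      using fK
    proof eventually_elim
      case (elim n)
      have "continuous_on (snd c ` K) l" "continuous_on (snd c ` K) (local_rep c c' (f n))"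
        using l(1) CF_local_rep[OF f c K elim] unfolding CF_compact_def by auto
      then show ?case
        unfolding chart_dist_def
        by (intro F_norm_cong[OF F Z] continuous_intros) (simp_all add: l_eq)
    qed
    from tendsto_cong[OF this] l(2)
    have "(\<lambda>n. chart_dist F c c' K g (f n)) \<longlonglongrightarrow> 0" by simp
    then show ?thesis
      using g_in cont CF_compact_cong[OF F Z l(1) l_eq] fK by blast
  qed
  have g_cont: "continuous_on UNIV g"
  proof (rule continuous_at_imp_continuous_on, intro ballI)
    fix x
    obtain c c' K where K: "(c, c', K) \<in> D" "x \<in> interior K" using cover by blast
    then show "isCont g x"
      using local[OF K(1)] continuous_on_interior by blast
  qed
  have "local_rep c2 c2' g \<in> CF_compact F (snd c2 ` K2)"
    if c2: "c2 \<in> A" "c2' \<in> B" and K2: "compact K2" "K2 \<subseteq> fst c2" "g ` K2 \<subseteq> fst c2'" for c2 c2' K2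
  proof -
    obtain D' where D': "D' \<subseteq> D" "finite D'" "K2 \<subseteq> (\<Union>d\<in>D'. interior (snd (snd d)))"
    proof (rule compactE_image[OF K2(1), of D "\<lambda>d. interior (snd (snd d))"])
      show "K2 \<subseteq> (\<Union>d\<in>D. interior (snd (snd d)))"
      proof
        fix x
        obtain c c' K where "(c, c', K) \<in> D" "x \<in> interior K" using cover by blast
        then show "x \<in> (\<Union>d\<in>D. interior (snd (snd d)))" by force
      qed
    qed auto
    define \<P> where "\<P> = (\<lambda>d. K2 \<inter> snd (snd d)) ` D'"
    have U: "\<Union>\<P> = K2"
      using D'(3) interior_subset unfolding \<P>_def by blast
    have piece: "compact P \<and> (\<forall>\<^sub>F n in sequentially. f n ` P \<subseteq> fst c2') \<and>
        (\<lambda>n. chart_dist F c2 c2' P g (f n)) \<longlonglongrightarrow> 0" if "P \<in> \<P>" for P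
    proof -
      obtain d where "d \<in> D'" "P = K2 \<inter> snd (snd d)"
        using \<open>P \<in> \<P>\<close> unfolding \<P>_def by blast
      moreover obtain c c' K where "d = (c, c', K)" by (rule prod_cases3)
      ultimately have d: "(c, c', K) \<in> D" and P: "P = K2 \<inter> K"
        using D'(1) by auto
      have c: "c \<in> A" "c' \<in> B" and K: "compact K" "K \<subseteq> fst c"
        using D[OF d] by auto
      have cP: "compact P" and PK: "P \<subseteq> K" and Pc: "P \<subseteq> fst c \<inter> fst c2"
        using K K2 unfolding P by (auto intro: compact_Int)
      have Zs: "compact (snd c ` K)" "compact (snd c ` P)" "snd c ` P \<subseteq> snd c ` K"
        using compact_image_A[OF c(1) K] compact_image_A[OF c(1) cP] Pc PK by auto
      have fK: "\<forall>\<^sub>F n in sequentially. f n ` K \<subseteq> fst c'" and gK: "local_rep c c' g \<in> CF_compact F (snd c ` K)"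
        using local[OF d] by auto
      have fP: "\<forall>\<^sub>F n in sequentially. f n ` P \<subseteq> fst c'"
        using fK by eventually_elim (use PK in blast)
      have gP: "local_rep c c' g \<in> CF_compact F (snd c ` P)"
        by (rule CF_compact_mono[OF F monotonicity Zs gK])
      have "\<forall>\<^sub>F n in sequentially. chart_dist F c c' P g (f n) \<le> chart_dist F c c' K g (f n)"
        using fK
      proof eventually_elim
        case (elim n)
        show ?case
          unfolding chart_dist_def
          by (intro F_norm_mono[OF F monotonicity Zs] CF_compact_diff[OF F Zs(1)] gK
              CF_local_rep[OF f c K elim])
      qed
      moreover have "(\<lambda>n. chart_dist F c c' K g (f n)) \<longlonglongrightarrow> 0"
        using local[OF d] by blast
      ultimately have lim: "(\<lambda>n. chart_dist F c c' P g (f n)) \<longlonglongrightarrow> 0"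
        by (rule tendsto_sandwich[OF _ _ tendsto_const, rotated]) simp
      have gP': "g ` P \<subseteq> fst c' \<inter> fst c2'"
        using local[OF d] K2(3) PK unfolding P by blast
      show ?thesis
        by (intro conjI cP change_of_charts[OF c(1) c2(1) c(2) c2(2) cP Pc f fP g_cont gP' gP lim])
    qed
    have "local_rep c2 c2' g \<in> CF_compact F (snd c2 ` \<Union>\<P>)"
    proof (rule glue_convergence(1)[where f=f, OF c2 _ _ _ f g_cont])
      show "finite \<P>" using D'(2) unfolding \<P>_def by simp
    qed (use piece K2 in \<open>auto simp only: U\<close>)
    then show ?thesis unfolding U .
  qed
  then have "g \<in> CF F A B"
    unfolding CF_def using g_cont by blast
  then show thesis
    using that[of g] local by blast
qed


section \<open>Compact neighbourhoods and coverings\<close>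

lemma compact_neighbourhood_in_chart:
  assumes c: "c \<in> A" and W: "open W" "x \<in> W" "x \<in> fst c"
  obtains K where "compact K" "K \<subseteq> fst c \<inter> W" "x \<in> interior K"
proof -
  let ?inv = "inv_into (fst c) (snd c)"
  note ch = is_chartD[OF chart_A[OF c]]
  have "open (snd c ` (fst c \<inter> W))"
    by (intro chart_image_open chart_A c open_Int ch W) simp
  then obtain r where r: "r > 0" "cball (snd c x) r \<subseteq> snd c ` (fst c \<inter> W)"
    using open_contains_cball W by blast
  define K where "K = ?inv ` cball (snd c x) r"
  have sub: "cball (snd c x) r \<subseteq> snd c ` fst c" using r(2) by blast
  have "compact K"
    unfolding K_def using ch(4) sub continuous_on_subset
    by (intro compact_continuous_image has_dimension_compact_cball[OF dim_v]) blast
  moreover have "K \<subseteq> fst c \<inter> W"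
  proof
    fix y assume "y \<in> K"
    then obtain z where z: "z \<in> fst c \<inter> W" "y = ?inv (snd c z)"
      unfolding K_def using r(2) by blast
    then show "y \<in> fst c \<inter> W" using ch(5) by simp
  qed
  moreover have "x \<in> interior K"
  proof (rule interiorI)
    show "open (fst c \<inter> snd c -` ball (snd c x) r)"
      by (intro continuous_open_preimage ch open_ball)
    show "x \<in> fst c \<inter> snd c -` ball (snd c x) r" using W r(1) by simp
    show "fst c \<inter> snd c -` ball (snd c x) r \<subseteq> K"
    proof
      fix y assume y: "y \<in> fst c \<inter> snd c -` ball (snd c x) r"
      then have "?inv (snd c y) = y" using ch(5) by simp
      moreover have "snd c y \<in> cball (snd c x) r" using y by auto
      ultimately show "y \<in> K" unfolding K_def by (metis imageI)
    qed
  qed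
  ultimately show thesis by (rule that)
qed

text \<open>
  These compact sets only fix which part of \<open>M\<close> has to be covered at stage \<open>n\<close> of the construction
  below; the charts are chosen at that stage, since they must fit the map reached by then.
\<close>

lemma sigma_compact:
  obtains L :: "nat \<Rightarrow> 'a set" where "\<And>n. compact (L n)" "(\<Union>n. L n) = UNIV"
proof -
  define \<I> where "\<I> = {interior K |K :: 'a set. compact K}"
  have "\<Union>\<I> = UNIV"
  proof -
    have "x \<in> \<Union>\<I>" for x
    proof -
      obtain c where "c \<in> A" "x \<in> fst c"
        using A unfolding smooth_structure_def by blast
      then obtain K where "compact K" "K \<subseteq> fst c \<inter> UNIV" "x \<in> interior K"
        by (rule compact_neighbourhood_in_chart[OF _ open_UNIV UNIV_I])
      then show ?thesis unfolding \<I>_def by blast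
    qed
    then show ?thesis by blast
  qed
  moreover obtain \<J> where J: "\<J> \<subseteq> \<I>" "countable \<J>" "\<Union>\<J> = \<Union>\<I>"
  proof (rule Lindelof[of \<I>])
    show "\<And>S. S \<in> \<I> \<Longrightarrow> open S" unfolding \<I>_def by auto
  qed
  ultimately have J_UNIV: "\<Union>\<J> = UNIV" by simp
  then have ne: "\<J> \<noteq> {}" by auto
  have "\<forall>n. \<exists>K. compact K \<and> from_nat_into \<J> n \<subseteq> K"
  proof
    fix n
    have "from_nat_into \<J> n \<in> \<I>" using J(1) from_nat_into[OF ne] by blast
    then obtain K where "compact K" "from_nat_into \<J> n = interior K"
      unfolding \<I>_def by blast
    then show "\<exists>K. compact K \<and> from_nat_into \<J> n \<subseteq> K"
      using interior_subset by blast
  qed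
  then obtain L where L: "\<And>n. compact (L n)" "\<And>n. from_nat_into \<J> n \<subseteq> L n" by metis
  have "x \<in> (\<Union>n. L n)" for x
  proof -
    have "x \<in> \<Union>\<J>" using J_UNIV by simp
    then obtain S where S: "S \<in> \<J>" "x \<in> S" by (rule UnionE)
    obtain n where "from_nat_into \<J> n = S"
      using from_nat_into_surj[OF J(2) S(1)] by (rule exE)
    then show ?thesis
      using L(2)[of n] S(2) by blast
  qed
  then have "(\<Union>n. L n) = UNIV" by blast
  with L(1) show thesis by (rule that)
qed

lemma finite_admissible_cover:
  assumes f: "f \<in> CF F A B" and L: "compact L"
  obtains Q where "finite Q" "\<And>q. q \<in> Q \<Longrightarrow> admissible A B f q"
    "\<And>x. x \<in> L \<Longrightarrow> \<exists>c c' K e. (c, c', K, e) \<in> Q \<and> x \<in> interior K"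
proof -
  have "\<exists>q. admissible A B f q \<and> x \<in> interior (fst (snd (snd q)))" for x
  proof -
    obtain c c' where c: "c \<in> A" "x \<in> fst c" "c' \<in> B" "f x \<in> fst c'"
      using A B unfolding smooth_structure_def by blast
    have "open (f -` fst c')"
      using CF_continuous[OF f] is_chartD(1)[OF chart_B[OF c(3)]] by (rule open_vimage[rotated])
    moreover have "x \<in> f -` fst c'"
      using c(4) by simp
    ultimately obtain K where "compact K" "K \<subseteq> fst c \<inter> f -` fst c'" "x \<in> interior K"
      by (rule compact_neighbourhood_in_chart[OF c(1) _ _ c(2)])
    then have "admissible A B f (c, c', K, 1) \<and> x \<in> interior (fst (snd (snd (c, c', K, 1))))"
      using c unfolding admissible_def by auto
    then show ?thesis by blast
  qed
  then obtain q where q: "\<And>x. admissible A B f (q x)" "\<And>x. x \<in> interior (fst (snd (snd (q x))))"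
    by metis
  obtain L' where L': "L' \<subseteq> L" "finite L'" "L \<subseteq> (\<Union>x\<in>L'. interior (fst (snd (snd (q x)))))"
    using compactE_image[OF L, of L "\<lambda>x. interior (fst (snd (snd (q x))))"] q(2) by blast
  show thesis
  proof (rule that[of "q ` L'"])
    fix x assume "x \<in> L"
    then obtain y where "y \<in> L'" "x \<in> interior (fst (snd (snd (q y))))" using L'(3) by blast
    then show "\<exists>c c' K e. (c, c', K, e) \<in> q ` L' \<and> x \<in> interior K"
      by (metis imageI prod.collapse)
  qed (use L'(2) q(1) in auto)
qed


section \<open>Tame neighbourhood data\<close>

definition closed_nbhd where
  "closed_nbhd f P = {g \<in> CF F A B. \<forall>(c, c', K, e) \<in> P. g ` K \<subseteq> fst c' \<and> chart_dist F c c' K f g \<le> e}"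

text \<open>
  Tame data have a radius so small that the maps within this distance of \<open>f\<close>, read in the charts,
  take their values in a fixed compact part of the target chart. Limits of such maps then cannot leave
  this chart. The bound \<open>\<eta>\<close> serves to let the radii tend to zero along a sequence of stages.
\<close>

definition tame where
  "tame f \<eta> = (\<lambda>(c, c', K, e). admissible A B f (c, c', K, e) \<and> e \<le> \<eta> \<and> e < \<infinity> \<and>
     (\<Union>x\<in>K. cball (snd c' (f x)) (enn2real e)) \<subseteq> snd c' ` fst c')"

lemma weak_nbhd_iff:
  "g \<in> weak_nbhd F A B f (c, c', K, e) \<longleftrightarrow>
    g \<in> CF F A B \<and> g ` K \<subseteq> fst c' \<and> chart_dist F c c' K f g < e"
  by (simp only: weak_nbhd_def chart_dist_def prod.case mem_Collect_eq)

lemma ball_quadruple: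
  "(\<forall>q\<in>Q. R q) \<longleftrightarrow> (\<forall>c c' K e. (c, c', K, e) \<in> Q \<longrightarrow> R (c, c', K, e))"
proof
  assume *: "\<forall>c c' K e. (c, c', K, e) \<in> Q \<longrightarrow> R (c, c', K, e)"
  show "\<forall>q\<in>Q. R q"
  proof
    fix q assume "q \<in> Q"
    moreover obtain c c' K e where "q = (c, c', K, e)" by (rule prod_cases4)
    ultimately show "R q" using * by simp
  qed
qed simp

lemma strong_nbhd_iff:
  "g \<in> strong_nbhd F A B f Q \<longleftrightarrow> g \<in> CF F A B \<and>
    (\<forall>c c' K e. (c, c', K, e) \<in> Q \<longrightarrow> g ` K \<subseteq> fst c' \<and> chart_dist F c c' K f g < e)"
  unfolding strong_nbhd_def by (simp only: mem_Collect_eq ball_quadruple weak_nbhd_iff) blast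

lemma closed_nbhd_iff:
  "g \<in> closed_nbhd f Q \<longleftrightarrow> g \<in> CF F A B \<and>
    (\<forall>c c' K e. (c, c', K, e) \<in> Q \<longrightarrow> g ` K \<subseteq> fst c' \<and> chart_dist F c c' K f g \<le> e)"
  unfolding closed_nbhd_def by (simp only: mem_Collect_eq ball_quadruple prod.case)

lemma tame_admissible: "tame f \<eta> q \<Longrightarrow> admissible A B f q"
  unfolding tame_def by (auto split: prod.splits)

lemma admissibleD:
  "admissible A B f (c, c', K, e) \<Longrightarrow>
    c \<in> A \<and> c' \<in> B \<and> compact K \<and> K \<subseteq> fst c \<and> f ` K \<subseteq> fst c' \<and> e > 0"
  unfolding admissible_def by simp

lemma compact_chart_values:
  assumes f: "f \<in> CF F A B" and ad: "admissible A B f (c, c', K, e)"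
  shows "compact ((\<lambda>x. snd c' (f x)) ` K)"
proof -
  have "continuous_on K (\<lambda>x. snd c' (f x))"
    using admissibleD[OF ad] is_chartD(3)[OF chart_B]
    by (intro continuous_on_compose2[of "fst c'" "snd c'" K f] CF_continuous[OF f]) auto
  then show ?thesis
    using admissibleD[OF ad] compact_continuous_image by blast
qed

lemma exists_tame_shrinking:
  assumes f: "f \<in> CF F A B" and ad: "admissible A B f (c, c', K, e)" and \<eta>: "\<eta> > 0"
  shows "\<exists>e'. e' < e \<and> tame f \<eta> (c, c', K, e')"
proof -
  have a: "c \<in> A" "c' \<in> B" "compact K" "K \<subseteq> fst c" "f ` K \<subseteq> fst c'" "e > 0"
    using admissibleD[OF ad] by auto
  have "(\<lambda>x. snd c' (f x)) ` K \<subseteq> snd c' ` fst c'"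
    using a(5) by blast
  from compact_subset_open_imp_cball_epsilon_subset[OF compact_chart_values[OF f ad]
      is_chartD(2)[OF chart_B[OF a(2)]] this]
  obtain r where r: "r > 0" "(\<Union>x\<in>(\<lambda>x. snd c' (f x)) ` K. cball x r) \<subseteq> snd c' ` fst c'"
    by blast
  obtain e' where e': "0 < e'" "e' < min (min \<eta> e) (ennreal r)"
    using dense[of 0 "min (min \<eta> e) (ennreal r)"] \<eta> a(6) r(1) by auto
  have fin: "e' < \<infinity>" using e'(2) by (auto simp: less_top[symmetric])
  have "enn2real e' \<le> r"
    using e'(2) r(1) by (intro enn2real_leI) auto
  then have "(\<Union>x\<in>K. cball (snd c' (f x)) (enn2real e')) \<subseteq> snd c' ` fst c'"
    using r(2) by (fastforce simp: subset_iff)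
  then have "tame f \<eta> (c, c', K, e')"
    using a e' fin unfolding tame_def admissible_def by auto
  then show ?thesis using e'(2) by auto
qed

lemma tame_confines:
  assumes f: "f \<in> CF F A B" and q: "tame f \<eta> (c, c', K, e)"
  obtains L where "compact L" "L \<subseteq> snd c' ` fst c'"
    "\<And>g. g ` K \<subseteq> fst c' \<Longrightarrow> chart_dist F c c' K f g \<le> e \<Longrightarrow> snd c' ` g ` K \<subseteq> L"
proof -
  define L where "L = (\<Union>y\<in>(\<lambda>x. snd c' (f x)) ` K. cball y (enn2real e))"
  have ad: "admissible A B f (c, c', K, e)" by (rule tame_admissible[OF q])
  have a: "c \<in> A" "K \<subseteq> fst c" using admissibleD[OF ad] by auto
  have e: "e < top" "L \<subseteq> snd c' ` fst c'" using q unfolding tame_def L_def by auto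
  show thesis
  proof (rule that)
    show "compact L"
      unfolding L_def by (rule has_dimension_compact_thickening[OF dim_w compact_chart_values[OF f ad]])
    fix g assume g: "g ` K \<subseteq> fst c'" "chart_dist F c c' K f g \<le> e"
    show "snd c' ` g ` K \<subseteq> L"
    proof
      fix y assume "y \<in> snd c' ` g ` K"
      then obtain x where x: "x \<in> K" "y = snd c' (g x)" by blast
      have "ennreal (norm (local_rep c c' f (snd c x) - local_rep c c' g (snd c x)))
          \<le> chart_dist F c c' K f g"
        unfolding chart_dist_def using x(1)
        by (intro norm_le_F_norm[of _ _ "\<lambda>y. local_rep c c' f y - local_rep c c' g y"]) blast
      then have "ennreal (norm (snd c' (f x) - snd c' (g x))) \<le> e"
        using g(2) by (simp add: local_rep_A[OF a(1) subsetD[OF a(2) x(1)]])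
      then have "norm (snd c' (f x) - snd c' (g x)) \<le> enn2real e"
        using enn2real_mono[of "ennreal (norm (snd c' (f x) - snd c' (g x)))" e] e(1) by simp
      then show "y \<in> L"
        using x unfolding L_def by (auto simp: dist_norm)
    qed
  qed (rule e(2))
qed


section \<open>Nested closed neighbourhoods\<close>

lemma recentre_admissible:
  assumes g: "g \<in> strong_nbhd F A B f P" and ad: "\<And>q. q \<in> P \<Longrightarrow> admissible A B f q" and q: "q \<in> P"
  shows "admissible A B g q"
proof -
  obtain c c' K e where qq: "q = (c, c', K, e)" by (rule prod_cases4)
  show ?thesis
    using ad[OF q] g q unfolding strong_nbhd_iff admissible_def qq by blast
qed

text \<open>
  Shrinking only the radii keeps the source charts, and hence the local finiteness of the family. A
  radius strictly below the given one turns the closed neighbourhood into a subset of the open one.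
\<close>

lemma tame_refinement:
  assumes f: "f \<in> CF F A B" and Q: "\<forall>q\<in>Q. admissible A B f q" and \<eta>: "\<eta> > 0"
  shows "\<exists>h :: ('a, 'v, 'b, 'w) nbhd_data \<Rightarrow> ('a, 'v, 'b, 'w) nbhd_data.
    (\<forall>q. fst (h q) = fst q) \<and> (\<forall>q\<in>Q. tame f \<eta> (h q)) \<and>
    closed_nbhd f (h ` Q) \<subseteq> strong_nbhd F A B f Q \<and>
    (\<forall>c c' K e. (c, c', K, e) \<in> Q \<longrightarrow> (\<exists>e'. (c, c', K, e') \<in> h ` Q))"
proof -
  have "\<forall>q. \<exists>e'. q \<in> Q \<longrightarrow> e' < snd (snd (snd q)) \<and>
      tame f \<eta> (fst q, fst (snd q), fst (snd (snd q)), e')"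
  proof
    fix q :: "('a, 'v, 'b, 'w) nbhd_data"
    obtain c c' K e where q: "q = (c, c', K, e)" by (rule prod_cases4)
    show "\<exists>e'. q \<in> Q \<longrightarrow> e' < snd (snd (snd q)) \<and>
        tame f \<eta> (fst q, fst (snd q), fst (snd (snd q)), e')"
      using exists_tame_shrinking[OF f _ \<eta>, of c c' K e] Q unfolding q by auto
  qed
  then obtain \<epsilon> where \<epsilon>: "\<And>q. q \<in> Q \<Longrightarrow> \<epsilon> q < snd (snd (snd q)) \<and>
      tame f \<eta> (fst q, fst (snd q), fst (snd (snd q)), \<epsilon> q)"
    by metis
  define h where "h q = (fst q, fst (snd q), fst (snd (snd q)), \<epsilon> q)" for q
  have mem: "(c, c', K, \<epsilon> (c, c', K, e)) \<in> h ` Q" if "(c, c', K, e) \<in> Q" for c c' K e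
    using imageI[OF that, of h] unfolding h_def by simp
  show ?thesis
  proof (intro exI[of _ h] conjI ballI allI impI)
    show "closed_nbhd f (h ` Q) \<subseteq> strong_nbhd F A B f Q"
    proof
      fix g assume g: "g \<in> closed_nbhd f (h ` Q)"
      have "g ` K \<subseteq> fst c' \<and> chart_dist F c c' K f g < e" if q: "(c, c', K, e) \<in> Q" for c c' K e
      proof -
        have "g ` K \<subseteq> fst c' \<and> chart_dist F c c' K f g \<le> \<epsilon> (c, c', K, e)"
          using g mem[OF q] unfolding closed_nbhd_iff by blast
        moreover have "\<epsilon> (c, c', K, e) < e"
          using \<epsilon>[OF q] by simp
        ultimately show ?thesis
          by (blast intro: le_less_trans)
      qed
      then show "g \<in> strong_nbhd F A B f Q"
        using g unfolding strong_nbhd_iff closed_nbhd_iff by blast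
    qed
    show "fst (h q) = fst q" for q
      unfolding h_def by simp
    show "tame f \<eta> (h q)" if "q \<in> Q" for q
      using \<epsilon>[OF that] unfolding h_def by simp
    show "\<exists>e'. (c, c', K, e') \<in> h ` Q" if "(c, c', K, e) \<in> Q" for c c' K e
      using mem[OF that] by (rule exI)
  qed
qed

text \<open>
  A neighbourhood of \<open>f\<close> contains one of each of its members \<open>g\<close>, obtained by changing only the
  radii. The predicate \<open>small\<close> stands for a bound on the size of the family of data that such a change
  respects; it will be finiteness for the weak topology and local finiteness for the strong one.
\<close>

lemma recentre_strong_nbhd:
  assumes small_image: "\<And>h. (\<And>q. fst (h q) = fst q) \<Longrightarrow> small (h ` Q)"
    and f: "f \<in> CF F A B" and Q: "\<And>q. q \<in> Q \<Longrightarrow> admissible A B f q"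
    and g: "g \<in> strong_nbhd F A B f Q"
  shows "\<exists>P. small P \<and> (\<forall>q\<in>P. admissible A B g q) \<and> strong_nbhd F A B g P \<subseteq> strong_nbhd F A B f Q"
proof -
  have "\<forall>q. \<exists>e. q \<in> Q \<longrightarrow> admissible A B g (fst q, fst (snd q), fst (snd (snd q)), e) \<and>
        weak_nbhd F A B g (fst q, fst (snd q), fst (snd (snd q)), e) \<subseteq> weak_nbhd F A B f q"
  proof (intro allI)
    fix q
    show "\<exists>e. q \<in> Q \<longrightarrow> admissible A B g (fst q, fst (snd q), fst (snd (snd q)), e) \<and>
        weak_nbhd F A B g (fst q, fst (snd q), fst (snd (snd q)), e) \<subseteq> weak_nbhd F A B f q"
    proof (cases "q \<in> Q")
      case True
      then have "admissible A B f q" "g \<in> weak_nbhd F A B f q"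
        using Q g unfolding strong_nbhd_def by blast+
      from weak_nbhd_recentre[OF A B F f this] show ?thesis by blast
    qed simp
  qed
  then obtain \<epsilon> where \<epsilon>: "\<And>q. q \<in> Q \<Longrightarrow> admissible A B g (fst q, fst (snd q), fst (snd (snd q)), \<epsilon> q)"
    "\<And>q. q \<in> Q \<Longrightarrow>
      weak_nbhd F A B g (fst q, fst (snd q), fst (snd (snd q)), \<epsilon> q) \<subseteq> weak_nbhd F A B f q"
    by metis
  define h where "h q = (fst q, fst (snd q), fst (snd (snd q)), \<epsilon> q)" for q
  have "small (h ` Q)"
    by (rule small_image) (simp add: h_def)
  moreover have "\<forall>q\<in>h ` Q. admissible A B g q"
    using \<epsilon>(1) unfolding h_def by blast
  moreover have "strong_nbhd F A B g (h ` Q) \<subseteq> strong_nbhd F A B f Q"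
    using \<epsilon>(2) unfolding strong_nbhd_def h_def by blast
  ultimately show ?thesis by blast
qed

lemma closed_nbhdD:
  assumes "g \<in> closed_nbhd f Q" "(c, c', K, e) \<in> Q"
  shows "g ` K \<subseteq> fst c'" "chart_dist F c c' K f g \<le> e"
  using assms unfolding closed_nbhd_iff by blast+

text \<open>
  The heart of the Baire argument: nested closed neighbourhoods have a common point. Every piece that
  occurs at some stage persists at all later stages, with radius at most \<open>1 / (n + 1)\<close> at stage \<open>n\<close>.
  So the centres are Cauchy on each piece, and tameness confines them. Their limit lies in each
  neighbourhood because the neighbourhood is described by non-strict inequalities on pieces where the
  centres converge to the limit.
\<close>

lemma nested_nbhds_common_point:
  assumes f: "\<And>n. f n \<in> CF F A B"
    and tame: "\<And>n q. q \<in> P n \<Longrightarrow> tame (f n) (ennreal (inverse (real (Suc n)))) q"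
    and later: "\<And>n k. n \<le> k \<Longrightarrow> f k \<in> closed_nbhd (f n) (P n)"
    and persist: "\<And>c c' K e n k. n \<le> k \<Longrightarrow> (c, c', K, e) \<in> P n \<Longrightarrow> \<exists>e'. (c, c', K, e') \<in> P k"
    and covers: "\<And>x. \<exists>n c c' K e. (c, c', K, e) \<in> P n \<and> x \<in> interior K"
  shows "\<exists>g. \<forall>n. g \<in> closed_nbhd (f n) (P n)"
proof -
  \<comment> \<open>The pieces with their charts, but without radii, which change from stage to stage.\<close>
  define D where "D = {(c, c', K). \<exists>n e. (c, c', K, e) \<in> P n}"
  have adD: "c \<in> A \<and> c' \<in> B \<and> compact K \<and> K \<subseteq> fst c" if d: "(c, c', K) \<in> D" for c c' K
  proof -
    obtain n e where "(c, c', K, e) \<in> P n" using d unfolding D_def by blast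
    from admissibleD[OF tame_admissible[OF tame[OF this]]] show ?thesis by blast
  qed
  obtain g where g: "g \<in> CF F A B" "\<And>c c' K. (c, c', K) \<in> D \<Longrightarrow> g ` K \<subseteq> fst c'"
    "\<And>c c' K. (c, c', K) \<in> D \<Longrightarrow> (\<lambda>n. chart_dist F c c' K g (f n)) \<longlonglongrightarrow> 0"
  proof (rule weak_limit_exists[OF f adD])
    fix x
    show "\<exists>c c' K. (c, c', K) \<in> D \<and> x \<in> interior K"
      using covers[of x] unfolding D_def by blast
  next
    fix c c' K assume "(c, c', K) \<in> D"
    then obtain n e where q: "(c, c', K, e) \<in> P n" unfolding D_def by blast
    obtain L where L: "compact L" "L \<subseteq> snd c' ` fst c'"
      "\<And>g. g ` K \<subseteq> fst c' \<Longrightarrow> chart_dist F c c' K (f n) g \<le> e \<Longrightarrow> snd c' ` g ` K \<subseteq> L"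
      by (rule tame_confines[OF f tame[OF q]]) (rule that)
    have "f k ` K \<subseteq> fst c' \<and> snd c' ` f k ` K \<subseteq> L" if "n \<le> k" for k
      using closed_nbhdD[OF later[OF that] q] L(3) by blast
    then have "\<forall>\<^sub>F k in sequentially. f k ` K \<subseteq> fst c' \<and> snd c' ` f k ` K \<subseteq> L"
      by (rule eventually_sequentiallyI)
    then show "\<exists>L. compact L \<and> L \<subseteq> snd c' ` fst c' \<and>
        (\<forall>\<^sub>F k in sequentially. f k ` K \<subseteq> fst c' \<and> snd c' ` f k ` K \<subseteq> L)"
      using L(1,2) by blast
  next
    fix c c' K and \<epsilon> :: ennreal assume d: "(c, c', K) \<in> D" and \<epsilon>: "\<epsilon> > 0"
    then obtain n e where q: "(c, c', K, e) \<in> P n" unfolding D_def by blast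
    obtain z where z: "0 < z" "z < \<epsilon>" using dense[OF \<epsilon>] by blast
    define r where "r = enn2real z"
    have "z < top" by (rule less_le_trans[OF z(2) top_greatest])
    then have r: "z = ennreal r" "r > 0"
      unfolding r_def using z(1) by (simp_all add: enn2real_positive_iff)
    obtain j where j: "inverse (real (Suc j)) < r / 2"
      using reals_Archimedean[of "r / 2"] r(2) by auto
    define k where "k = max n j"
    obtain e' where e': "(c, c', K, e') \<in> P k"
      using persist[OF _ q, of k] unfolding k_def by auto
    have "e' \<le> ennreal (inverse (real (Suc k)))"
      using tame[OF e'] unfolding tame_def by simp
    also have "\<dots> \<le> ennreal (r / 2)"
    proof (rule ennreal_leI)
      have "inverse (real (Suc k)) \<le> inverse (real (Suc j))"
        unfolding k_def by (intro le_imp_inverse_le) simp_all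
      then show "inverse (real (Suc k)) \<le> r / 2"
        using less_imp_le[OF j] by (rule order_trans)
    qed
    finally have e'_le: "e' \<le> ennreal (r / 2)" .
    have ad: "c \<in> A" "c' \<in> B" "compact K" "K \<subseteq> fst c" using adD[OF d] by auto
    have "chart_dist F c c' K (f i) (f i') < \<epsilon>" if i: "i \<ge> k" "i' \<ge> k" for i i'
    proof -
      have fi: "f i ` K \<subseteq> fst c'" "f i' ` K \<subseteq> fst c'" "f k ` K \<subseteq> fst c'"
        "chart_dist F c c' K (f k) (f i) \<le> e'" "chart_dist F c c' K (f k) (f i') \<le> e'"
        by (rule closed_nbhdD[OF later[OF i(1)] e'] closed_nbhdD[OF later[OF i(2)] e']
            closed_nbhdD[OF later[OF order_refl] e'])+
      have "chart_dist F c c' K (f i) (f i')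
          \<le> chart_dist F c c' K (f i) (f k) + chart_dist F c c' K (f k) (f i')"
        by (intro chart_dist_triangle ad fi CF_continuous[OF f])
      also have "chart_dist F c c' K (f i) (f k) = chart_dist F c c' K (f k) (f i)"
        by (intro chart_dist_commute ad fi CF_continuous[OF f])
      also have "chart_dist F c c' K (f k) (f i) + chart_dist F c c' K (f k) (f i') \<le> e' + e'"
        by (intro add_mono fi)
      also have "\<dots> \<le> ennreal (r / 2) + ennreal (r / 2)"
        by (intro add_mono e'_le)
      also have "\<dots> = z"
        using r by (simp flip: ennreal_plus)
      also have "\<dots> < \<epsilon>" by (rule z(2))
      finally show ?thesis .
    qed
    then show "\<exists>n0. \<forall>i\<ge>n0. \<forall>j\<ge>n0. chart_dist F c c' K (f i) (f j) < \<epsilon>" by blast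
  qed (assumption, rule that)
  have "g \<in> closed_nbhd (f n) (P n)" for n
  proof -
    have "g ` K \<subseteq> fst c' \<and> chart_dist F c c' K (f n) g \<le> e" if q: "(c, c', K, e) \<in> P n" for c c' K e
    proof
      have d: "(c, c', K) \<in> D" using q unfolding D_def by blast
      have ad: "c \<in> A" "c' \<in> B" "compact K" "K \<subseteq> fst c" using adD[OF d] by auto
      show gK: "g ` K \<subseteq> fst c'" by (rule g(2)[OF d])
      have "chart_dist F c c' K (f n) g \<le> e + chart_dist F c c' K g (f k)" if k: "k \<ge> n" for k
      proof -
        have fk: "f n ` K \<subseteq> fst c'" "f k ` K \<subseteq> fst c'" "chart_dist F c c' K (f n) (f k) \<le> e"
          by (rule closed_nbhdD[OF later[OF order_refl] q] closed_nbhdD[OF later[OF k] q])+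
        have "chart_dist F c c' K (f n) g
            \<le> chart_dist F c c' K (f n) (f k) + chart_dist F c c' K (f k) g"
          by (intro chart_dist_triangle ad fk gK CF_continuous[OF f] CF_continuous[OF g(1)])
        also have "chart_dist F c c' K (f k) g = chart_dist F c c' K g (f k)"
          by (intro chart_dist_commute ad fk gK CF_continuous[OF f] CF_continuous[OF g(1)])
        finally show ?thesis
          using fk(3) by (meson add_right_mono order_trans)
      qed
      moreover have "(\<lambda>k. e + chart_dist F c c' K g (f k)) \<longlonglongrightarrow> e + 0"
        by (intro tendsto_add tendsto_const g(3)[OF d])
      ultimately show "chart_dist F c c' K (f n) g \<le> e"
        using LIMSEQ_le_const[of "\<lambda>k. e + chart_dist F c c' K g (f k)"] by auto
    qed
    then show ?thesis
      unfolding closed_nbhd_iff using g(1) by blast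
  qed
  then show ?thesis by blast
qed

lemma strong_nbhd_subset_closed_nbhd: "strong_nbhd F A B f P \<subseteq> closed_nbhd f P"
  unfolding strong_nbhd_iff closed_nbhd_iff subset_iff by (meson less_imp_le)

lemma self_in_strong_nbhd:
  assumes "f \<in> CF F A B" "\<And>q. q \<in> P \<Longrightarrow> admissible A B f q"
  shows "f \<in> strong_nbhd F A B f P"
  using self_in_weak_nbhd[OF A B F assms(1) assms(2)] assms(1) unfolding strong_nbhd_def by blast

end

section \<open>The Baire property\<close>

text \<open>
  What the Baire argument uses of the two topologies: their open sets are described by the same
  neighbourhoods, taken over families of data that are \<open>small\<close> in the respective sense. Finite
  families must be small, since the charts covering one more compact set are added at each stage.
\<close>

locale whitney_topology = whitney F A B m d
  for F :: "('v::real_inner, 'w::real_inner) seminorms"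
    and A :: "('a::{t2_space, second_countable_topology}, 'v) chart set"
    and B :: "('b::{t2_space, second_countable_topology}, 'w) chart set"
    and m d :: nat +
  fixes small :: "('a, 'v, 'b, 'w) nbhd_data set \<Rightarrow> bool" and X :: "('a \<Rightarrow> 'b) topology"
  assumes small_finite: "finite Q \<Longrightarrow> small Q"
    and small_Un: "small P \<Longrightarrow> small Q \<Longrightarrow> small (P \<union> Q)"
    and small_image: "small Q \<Longrightarrow> (\<And>q. fst (h q) = fst q) \<Longrightarrow> small (h ` Q)"
    and openin_iff: "openin X S \<longleftrightarrow> S \<subseteq> CF F A B \<and> (\<forall>f\<in>S. \<exists>Q. small Q \<and>
      (\<forall>q\<in>Q. admissible A B f q) \<and> strong_nbhd F A B f Q \<subseteq> S)"
begin

lemma openin_strong_nbhd: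
  assumes f: "f \<in> CF F A B" and Q: "small Q" "\<And>q. q \<in> Q \<Longrightarrow> admissible A B f q"
  shows "openin X (strong_nbhd F A B f Q)"
proof -
  have "\<exists>P. small P \<and> (\<forall>q\<in>P. admissible A B g q) \<and> strong_nbhd F A B g P \<subseteq> strong_nbhd F A B f Q"
    if g: "g \<in> strong_nbhd F A B f Q" for g
    by (rule recentre_strong_nbhd[where small=small and Q=Q and f=f and g=g])
      (use small_image[OF Q(1)] Q(2) f g in blast)+
  moreover have "strong_nbhd F A B f Q \<subseteq> CF F A B"
    unfolding strong_nbhd_def by blast
  ultimately show ?thesis
    unfolding openin_iff by blast
qed

text \<open>
  One stage of the construction. The pieces of the previous stage, \<open>R\<close>, are carried along with new
  radii, so that the sequence will be Cauchy on them, and pieces covering \<open>L\<close> are added.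
\<close>

lemma tame_nbhd_in_open:
  assumes S: "openin X S" "f \<in> S" and R: "small R" "\<forall>q\<in>R. admissible A B f q"
    and L: "compact L" and \<eta>: "\<eta> > 0"
  shows "\<exists>P. small P \<and> (\<forall>q\<in>P. tame f \<eta> q) \<and> closed_nbhd f P \<subseteq> S \<and>
    (\<forall>x\<in>L. \<exists>c c' K e. (c, c', K, e) \<in> P \<and> x \<in> interior K) \<and>
    (\<forall>c c' K e. (c, c', K, e) \<in> R \<longrightarrow> (\<exists>e'. (c, c', K, e') \<in> P))"
proof -
  obtain Q where Q: "small Q" "\<forall>q\<in>Q. admissible A B f q" "strong_nbhd F A B f Q \<subseteq> S"
    using S unfolding openin_iff by blast
  have f: "f \<in> CF F A B"
    using S unfolding openin_iff by blast
  obtain Q' where Q': "finite Q'" "\<And>q. q \<in> Q' \<Longrightarrow> admissible A B f q"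
    "\<And>x. x \<in> L \<Longrightarrow> \<exists>c c' K e. (c, c', K, e) \<in> Q' \<and> x \<in> interior K"
    using finite_admissible_cover[OF f L] by metis
  define T where "T = Q \<union> Q' \<union> R"
  have T_small: "small T"
    unfolding T_def by (intro small_Un small_finite Q(1) Q'(1) R(1))
  have T: "\<forall>q\<in>T. admissible A B f q"
    using Q(2) Q'(2) R(2) unfolding T_def by blast
  obtain h where h: "\<forall>q. fst (h q) = fst q" "\<forall>q\<in>T. tame f \<eta> (h q)"
    "closed_nbhd f (h ` T) \<subseteq> strong_nbhd F A B f T"
    "\<forall>c c' K e. (c, c', K, e) \<in> T \<longrightarrow> (\<exists>e'. (c, c', K, e') \<in> h ` T)"
    using tame_refinement[where Q=T, OF f T \<eta>] by (elim exE conjE)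
  have "small (h ` T)"
    using T_small by (rule small_image) (rule h(1)[THEN spec])
  moreover have "closed_nbhd f (h ` T) \<subseteq> S"
  proof -
    have "strong_nbhd F A B f T \<subseteq> strong_nbhd F A B f Q"
      unfolding strong_nbhd_def T_def by blast
    then show ?thesis using h(3) Q(3) by (meson order_trans)
  qed
  moreover have "\<exists>c c' K e. (c, c', K, e) \<in> h ` T \<and> x \<in> interior K" if x: "x \<in> L" for x
  proof -
    obtain c c' K e where "(c, c', K, e) \<in> Q'" "x \<in> interior K" using Q'(3)[OF x] by (elim exE conjE)
    moreover from this have "(c, c', K, e) \<in> T" unfolding T_def by simp
    ultimately show ?thesis using h(4) by (meson)
  qed
  moreover have "\<exists>e'. (c, c', K, e') \<in> h ` T" if "(c, c', K, e) \<in> R" for c c' K e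
  proof -
    have "(c, c', K, e) \<in> T" using that unfolding T_def by simp
    then show ?thesis using h(4) by (meson)
  qed
  ultimately show ?thesis
    using h(2) by (intro exI[of _ "h ` T"]) simp
qed

text \<open>
  The usual construction in Baire's theorem. A stage is a pair of a centre and its neighbourhood data;
  the next centre is taken in the next dense set and in the open neighbourhood of the present stage.
\<close>

lemma dense_sequence_meets_open:
  fixes U :: "nat \<Rightarrow> ('a \<Rightarrow> 'b) set"
  assumes U: "\<And>n. openin X (U n)" "\<And>n S. openin X S \<Longrightarrow> S \<noteq> {} \<Longrightarrow> U n \<inter> S \<noteq> {}"
    and W: "openin X W" "W \<noteq> {}"
  shows "\<exists>g\<in>W. \<forall>n. g \<in> U n"
proof -
  obtain L :: "nat \<Rightarrow> 'a set" where L: "\<And>n. compact (L n)" "(\<Union>n. L n) = UNIV"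
    by (rule sigma_compact) (rule that)
  define \<eta> where "\<eta> n = ennreal (inverse (real (Suc n)))" for n
  have \<eta>: "\<eta> n > 0" for n
    unfolding \<eta>_def by simp
  define Inv where "Inv n s \<longleftrightarrow> fst s \<in> CF F A B \<and> small (snd s) \<and>
      (\<forall>q\<in>snd s. tame (fst s) (\<eta> n) q) \<and> closed_nbhd (fst s) (snd s) \<subseteq> U n \<inter> W \<and>
      (\<forall>x\<in>L n. \<exists>c c' K e. (c, c', K, e) \<in> snd s \<and> x \<in> interior K)" for n s
  define Step where "Step s t \<longleftrightarrow> closed_nbhd (fst t) (snd t) \<subseteq> closed_nbhd (fst s) (snd s) \<and>
      (\<forall>c c' K e. (c, c', K, e) \<in> snd s \<longrightarrow> (\<exists>e'. (c, c', K, e') \<in> snd t))"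
    for s t :: "('a \<Rightarrow> 'b) \<times> ('a, 'v, 'b, 'w) nbhd_data set"
  have "\<exists>s. \<forall>n. Inv n (s n) \<and> Step (s n) (s (Suc n))"
  proof (rule dependent_nat_choice)
    obtain f where f: "f \<in> U 0 \<inter> W"
      using U(2)[OF W] by blast
    have S: "openin X (U 0 \<inter> W)"
      by (intro openin_Int U(1) W(1))
    have "f \<in> CF F A B"
      using f openin_iff[of W] W(1) by blast
    then show "\<exists>s. Inv 0 s"
      using tame_nbhd_in_open[OF S f small_finite[OF finite.emptyI] _ L(1)[of 0] \<eta>[of 0]]
      unfolding Inv_def by fastforce
  next
    fix s n assume s: "Inv n s"
    obtain f P where fP: "s = (f, P)" by (cases s)
    have f: "f \<in> CF F A B" "small P" "\<And>q. q \<in> P \<Longrightarrow> admissible A B f q" "closed_nbhd f P \<subseteq> W"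
      using s tame_admissible unfolding Inv_def fP by auto
    let ?S = "strong_nbhd F A B f P"
    have "?S \<noteq> {}" "openin X ?S"
      using self_in_strong_nbhd[OF f(1,3)] openin_strong_nbhd[OF f(1-3)] by blast+
    then obtain f' where f': "f' \<in> U (Suc n) \<inter> ?S"
      using U(2)[of ?S "Suc n"] by blast
    have S: "openin X (U (Suc n) \<inter> ?S)"
      by (intro openin_Int U(1) \<open>openin X ?S\<close>)
    have f'S: "f' \<in> ?S" using f' by simp
    have "\<forall>q\<in>P. admissible A B f' q"
      using recentre_admissible[OF f'S f(3)] by blast
    from tame_nbhd_in_open[OF S f' f(2) this L(1)[of "Suc n"] \<eta>[of "Suc n"]]
    obtain P' where P': "small P'" "\<forall>q\<in>P'. tame f' (\<eta> (Suc n)) q"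
      "closed_nbhd f' P' \<subseteq> U (Suc n) \<inter> ?S"
      "\<forall>x\<in>L (Suc n). \<exists>c c' K e. (c, c', K, e) \<in> P' \<and> x \<in> interior K"
      "\<forall>c c' K e. (c, c', K, e) \<in> P \<longrightarrow> (\<exists>e'. (c, c', K, e') \<in> P')"
      by (elim exE conjE)
    have sub: "closed_nbhd f' P' \<subseteq> closed_nbhd f P"
      using P'(3) strong_nbhd_subset_closed_nbhd[of f P] by blast
    have "f' \<in> CF F A B"
      using f'S unfolding strong_nbhd_def by blast
    moreover have "closed_nbhd f' P' \<subseteq> U (Suc n) \<inter> W"
      using P'(3) sub f(4) by blast
    ultimately have "Inv (Suc n) (f', P')"
      unfolding Inv_def fst_conv snd_conv using P'(1,2,4) by (intro conjI)
    moreover have "Step s (f', P')"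
      unfolding Step_def fP fst_conv snd_conv using sub P'(5) by (rule conjI)
    ultimately show "\<exists>t. Inv (Suc n) t \<and> Step s t"
      by blast
  qed
  then obtain s where s: "\<And>n. Inv n (s n)" "\<And>n. Step (s n) (s (Suc n))" by blast
  define f where "f n = fst (s n)" for n
  define P where "P n = snd (s n)" for n
  have f: "f n \<in> CF F A B" and tame: "\<And>q. q \<in> P n \<Longrightarrow> tame (f n) (\<eta> n) q"
    and into: "closed_nbhd (f n) (P n) \<subseteq> U n \<inter> W"
    and covers: "\<And>x. x \<in> L n \<Longrightarrow> \<exists>c c' K e. (c, c', K, e) \<in> P n \<and> x \<in> interior K" for n
    using s(1)[of n] unfolding Inv_def f_def P_def by simp_all
  have step: "closed_nbhd (f (Suc n)) (P (Suc n)) \<subseteq> closed_nbhd (f n) (P n)"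
    "\<And>c c' K e. (c, c', K, e) \<in> P n \<Longrightarrow> \<exists>e'. (c, c', K, e') \<in> P (Suc n)" for n
    using s(2)[of n] unfolding Step_def f_def P_def by blast+
  have in_self: "f n \<in> closed_nbhd (f n) (P n)" for n
    using self_in_strong_nbhd[OF f tame_admissible[OF tame]] strong_nbhd_subset_closed_nbhd by blast
  have decreasing: "closed_nbhd (f k) (P k) \<subseteq> closed_nbhd (f n) (P n)" if "n \<le> k" for n k
    using step(1) that by (rule lift_Suc_antimono_le[where f="\<lambda>n. closed_nbhd (f n) (P n)"])
  have later: "f k \<in> closed_nbhd (f n) (P n)" if "n \<le> k" for n k
    using decreasing[OF that] in_self by blast
  have persist: "\<exists>e'. (c, c', K, e') \<in> P k" if "n \<le> k" "(c, c', K, e) \<in> P n" for c c' K e n k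
    using that
  proof (induction k rule: dec_induct)
    case base
    then show ?case by (rule exI)
  next
    case (step k)
    then show ?case using \<open>\<And>n c c' K e. (c, c', K, e) \<in> P n \<Longrightarrow> \<exists>e'. (c, c', K, e') \<in> P (Suc n)\<close> by blast
  qed
  have covers': "\<exists>n c c' K e. (c, c', K, e) \<in> P n \<and> x \<in> interior K" for x
  proof -
    have "x \<in> (\<Union>n. L n)" using L(2) by simp
    then obtain n where "x \<in> L n" by (rule UN_E)
    from covers[OF this] show ?thesis by (rule exI)
  qed
  have "\<exists>g. \<forall>n. g \<in> closed_nbhd (f n) (P n)"
  proof (rule nested_nbhds_common_point)
    show "tame (f n) (ennreal (inverse (real (Suc n)))) q" if "q \<in> P n" for n q
      using tame[OF that] unfolding \<eta>_def .
  qed (fact f later persist covers')+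
  then obtain g where "\<forall>n. g \<in> closed_nbhd (f n) (P n)" ..
  then show ?thesis
    using into by blast
qed

lemma baire_property_X: "baire_property X"
proof -
  have "X closure_of (topspace X \<inter> \<Inter>\<U>) = topspace X"
    if \<U>: "countable \<U>" "\<And>U. U \<in> \<U> \<Longrightarrow> openin X U \<and> X closure_of U = topspace X" for \<U>
  proof -
    \<comment> \<open>Adding the whole space makes the family nonempty, so that it can be enumerated.\<close>
    define U where "U = from_nat_into (insert (topspace X) \<U>)"
    have range_U: "range U = insert (topspace X) \<U>"
      unfolding U_def using \<U>(1) by (intro range_from_nat_into) auto
    have U: "openin X (U n)" "X closure_of U n = topspace X" for n
    proof -
      have "U n = topspace X \<or> U n \<in> \<U>" using range_U by blast
      then show "openin X (U n)" "X closure_of U n = topspace X"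
        using \<U>(2) by (auto simp: closure_of_topspace)
    qed
    have dense: "U n \<inter> S \<noteq> {}" if "openin X S" "S \<noteq> {}" for n S
      using U(2)[of n] that unfolding dense_intersects_open by simp
    have "(topspace X \<inter> \<Inter>\<U>) \<inter> W \<noteq> {}" if W: "openin X W" "W \<noteq> {}" for W
    proof -
      have "\<exists>g\<in>W. \<forall>n. g \<in> U n"
        by (rule dense_sequence_meets_open) (use U(1) dense W in blast)+
      then obtain g where g: "g \<in> W" "\<forall>n. g \<in> U n" by (rule bexE)
      then have "g \<in> \<Inter>(range U)" by simp
      then show ?thesis
        using g(1) unfolding range_U by auto
    qed
    then show ?thesis
      unfolding dense_intersects_open by simp
  qed
  then show ?thesis
    unfolding baire_property_def by simp
qed

end


section \<open>Neighbourhoods in the weak and the strong topology\<close>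

lemma strong_nbhd_Un: "strong_nbhd F A B f (P \<union> Q) = strong_nbhd F A B f P \<inter> strong_nbhd F A B f Q"
  unfolding strong_nbhd_def by blast

lemma locally_finite_charts_finite:
  assumes "finite Q"
  shows "locally_finite_charts Q"
  unfolding locally_finite_charts_def using assms by (intro allI exI[of _ UNIV]) simp

lemma locally_finite_charts_Un:
  assumes "locally_finite_charts P" "locally_finite_charts Q"
  shows "locally_finite_charts (P \<union> Q)"
  unfolding locally_finite_charts_def
proof
  fix x
  obtain W where W: "open W" "x \<in> W" "finite {q \<in> P. fst (fst q) \<inter> W \<noteq> {}}"
    using assms(1) unfolding locally_finite_charts_def by blast
  obtain W' where W': "open W'" "x \<in> W'" "finite {q \<in> Q. fst (fst q) \<inter> W' \<noteq> {}}"
    using assms(2) unfolding locally_finite_charts_def by blast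
  have "finite {q \<in> P \<union> Q. fst (fst q) \<inter> (W \<inter> W') \<noteq> {}}"
    by (rule finite_subset[OF _ finite_UnI[OF W(3) W'(3)]]) auto
  then show "\<exists>W. open W \<and> x \<in> W \<and> finite {q \<in> P \<union> Q. fst (fst q) \<inter> W \<noteq> {}}"
    using W W' by (intro exI[of _ "W \<inter> W'"]) (simp add: open_Int)
qed

lemma locally_finite_charts_image:
  assumes "locally_finite_charts Q" "\<And>q. fst (h q) = fst q"
  shows "locally_finite_charts (h ` Q)"
  unfolding locally_finite_charts_def
proof
  fix x
  obtain W where W: "open W" "x \<in> W" "finite {q \<in> Q. fst (fst q) \<inter> W \<noteq> {}}"
    using assms(1) unfolding locally_finite_charts_def by blast
  have "{q \<in> h ` Q. fst (fst q) \<inter> W \<noteq> {}} \<subseteq> h ` {q \<in> Q. fst (fst q) \<inter> W \<noteq> {}}"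
    using assms(2) by (intro subsetI, elim CollectE conjE imageE) simp
  then show "\<exists>W. open W \<and> x \<in> W \<and> finite {q \<in> h ` Q. fst (fst q) \<inter> W \<noteq> {}}"
    using W finite_surj by blast
qed

context whitney
begin

text \<open>
  Despite its name, \<open>strong_nbhd\<close> over a finite family is a finite intersection of sub-basic sets of
  the weak topology. This is what makes a common treatment of both topologies possible.
\<close>

lemma openin_weak_nbhds:
  assumes "f \<in> CF F A B" "finite Q" "\<forall>q\<in>Q. admissible A B f q"
  shows "openin (weak_whitney_topology F A B) (strong_nbhd F A B f Q)"
  using assms(2,1,3)
proof (induction Q)
  case empty
  have "strong_nbhd F A B f {} = topspace (weak_whitney_topology F A B)"
    unfolding topspace_weak_whitney_topology[OF A B F] strong_nbhd_def by simp
  then show ?case by simp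
next
  case (insert q Q)
  have "openin (weak_whitney_topology F A B) (weak_nbhd F A B f q)"
    unfolding weak_whitney_topology_def
    using insert.prems by (intro topology_generated_by_Basis) blast
  moreover have "strong_nbhd F A B f (insert q Q) = weak_nbhd F A B f q \<inter> strong_nbhd F A B f Q"
    unfolding strong_nbhd_def weak_nbhd_def by (auto split: prod.splits)
  ultimately show ?case
    using insert by (simp add: openin_Int)
qed

lemma weak_open_nbhd:
  assumes "openin (weak_whitney_topology F A B) S" "f \<in> S"
  shows "\<exists>Q. finite Q \<and> (\<forall>q\<in>Q. admissible A B f q) \<and> strong_nbhd F A B f Q \<subseteq> S"
proof -
  have "generate_topology_on
      {weak_nbhd F A B f q |f q. f \<in> CF F A B \<and> admissible A B f q} S"
    using assms(1) unfolding weak_whitney_topology_def by (rule openin_topology_generated_by)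
  then show ?thesis
    using assms(2)
  proof (induction arbitrary: f)
    case Empty
    then show ?case by simp
  next
    case (Int S T)
    obtain P where P: "finite P" "\<forall>q\<in>P. admissible A B f q" "strong_nbhd F A B f P \<subseteq> S"
      using Int.IH(1)[of f] Int.prems by auto
    obtain Q where Q: "finite Q" "\<forall>q\<in>Q. admissible A B f q" "strong_nbhd F A B f Q \<subseteq> T"
      using Int.IH(2)[of f] Int.prems by auto
    show ?case
      by (rule exI[of _ "P \<union> Q"]) (use P Q in \<open>auto simp: strong_nbhd_Un\<close>)
  next
    case (UN \<S>)
    then obtain S where "S \<in> \<S>" "f \<in> S" by blast
    from UN.IH[OF this] this(1) show ?case by (meson Union_upper order_trans)
  next
    case (Basis S)
    then obtain g q where g: "g \<in> CF F A B" "admissible A B g q" "S = weak_nbhd F A B g q"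
      by blast
    have S: "S = strong_nbhd F A B g {q}"
      unfolding g(3) strong_nbhd_def weak_nbhd_def by (auto split: prod.splits)
    show ?case
      unfolding S
      by (rule recentre_strong_nbhd[where small=finite and Q="{q}"])
        (use g Basis.prems S in auto)
  qed
qed

lemma strong_open_nbhd:
  assumes "openin (strong_whitney_topology F A B) S" "f \<in> S"
  shows "\<exists>Q. locally_finite_charts Q \<and> (\<forall>q\<in>Q. admissible A B f q) \<and> strong_nbhd F A B f Q \<subseteq> S"
proof -
  obtain W where W: "W \<in> strong_base F A B" "f \<in> W" "W \<subseteq> S"
    using assms unfolding openin_strong_whitney_topology[OF A B F] union_of_def by auto
  obtain g Q where g: "g \<in> CF F A B" "locally_finite_charts Q" "\<forall>q\<in>Q. admissible A B g q"
    and W_eq: "W = strong_nbhd F A B g Q"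
    using W(1) unfolding strong_base_def by blast
  have "\<exists>P. locally_finite_charts P \<and> (\<forall>q\<in>P. admissible A B f q) \<and>
      strong_nbhd F A B f P \<subseteq> strong_nbhd F A B g Q"
  proof (rule recentre_strong_nbhd[where small=locally_finite_charts and Q=Q])
    show "locally_finite_charts (h ` Q)" if "\<And>q. fst (h q) = fst q" for h
      using g(2) that by (rule locally_finite_charts_image)
    show "f \<in> strong_nbhd F A B g Q" using W(2) W_eq by simp
  qed (use g in blast)+
  then show ?thesis
    using W(3) W_eq by blast
qed

lemma openin_strong_nbhds:
  assumes "f \<in> CF F A B" "locally_finite_charts Q" "\<forall>q\<in>Q. admissible A B f q"
  shows "openin (strong_whitney_topology F A B) (strong_nbhd F A B f Q)"
proof -
  have "strong_nbhd F A B f Q \<in> strong_base F A B"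
    using assms unfolding strong_base_def by blast
  then show ?thesis
    unfolding openin_strong_whitney_topology[OF A B F] by (rule union_of_inc[rotated]) (simp add: arbitrary_def)
qed

lemma openin_by_nbhds:
  assumes open_nbhd: "\<And>f Q. f \<in> CF F A B \<Longrightarrow> small Q \<Longrightarrow> \<forall>q\<in>Q. admissible A B f q \<Longrightarrow>
      openin X (strong_nbhd F A B f Q)"
    and S: "S \<subseteq> CF F A B"
      "\<And>f. f \<in> S \<Longrightarrow> \<exists>Q. small Q \<and> (\<forall>q\<in>Q. admissible A B f q) \<and> strong_nbhd F A B f Q \<subseteq> S"
  shows "openin X S"
proof (subst openin_subopen, intro ballI)
  fix f assume f: "f \<in> S"
  obtain Q where Q: "small Q" "\<forall>q\<in>Q. admissible A B f q" "strong_nbhd F A B f Q \<subseteq> S"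
    using S(2)[OF f] by blast
  have fCF: "f \<in> CF F A B" using f S(1) by blast
  have "f \<in> strong_nbhd F A B f Q"
    using self_in_strong_nbhd[OF fCF] Q(2) by blast
  then show "\<exists>T. openin X T \<and> f \<in> T \<and> T \<subseteq> S"
    using open_nbhd[OF fCF Q(1,2)] Q(3) by blast
qed

lemma weak_openin_iff:
  "openin (weak_whitney_topology F A B) S \<longleftrightarrow> S \<subseteq> CF F A B \<and>
    (\<forall>f\<in>S. \<exists>Q. finite Q \<and> (\<forall>q\<in>Q. admissible A B f q) \<and> strong_nbhd F A B f Q \<subseteq> S)"
proof
  assume S: "openin (weak_whitney_topology F A B) S"
  then have "S \<subseteq> CF F A B"
    using openin_subset topspace_weak_whitney_topology[OF A B F] by blast
  then show "S \<subseteq> CF F A B \<and>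
    (\<forall>f\<in>S. \<exists>Q. finite Q \<and> (\<forall>q\<in>Q. admissible A B f q) \<and> strong_nbhd F A B f Q \<subseteq> S)"
    using weak_open_nbhd[OF S] by simp
next
  assume S: "S \<subseteq> CF F A B \<and>
    (\<forall>f\<in>S. \<exists>Q. finite Q \<and> (\<forall>q\<in>Q. admissible A B f q) \<and> strong_nbhd F A B f Q \<subseteq> S)"
  show "openin (weak_whitney_topology F A B) S"
    by (rule openin_by_nbhds[where small=finite, OF openin_weak_nbhds], assumption+) (use S in blast)+
qed

lemma strong_openin_iff:
  "openin (strong_whitney_topology F A B) S \<longleftrightarrow> S \<subseteq> CF F A B \<and>
    (\<forall>f\<in>S. \<exists>Q. locally_finite_charts Q \<and> (\<forall>q\<in>Q. admissible A B f q) \<and> strong_nbhd F A B f Q \<subseteq> S)"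
proof
  assume S: "openin (strong_whitney_topology F A B) S"
  then have "S \<subseteq> CF F A B"
    using openin_subset topspace_strong_whitney_topology[OF A B F] by blast
  then show "S \<subseteq> CF F A B \<and> (\<forall>f\<in>S. \<exists>Q. locally_finite_charts Q \<and>
      (\<forall>q\<in>Q. admissible A B f q) \<and> strong_nbhd F A B f Q \<subseteq> S)"
    using strong_open_nbhd[OF S] by simp
next
  assume S: "S \<subseteq> CF F A B \<and> (\<forall>f\<in>S. \<exists>Q. locally_finite_charts Q \<and>
      (\<forall>q\<in>Q. admissible A B f q) \<and> strong_nbhd F A B f Q \<subseteq> S)"
  show "openin (strong_whitney_topology F A B) S"
    by (rule openin_by_nbhds[where small=locally_finite_charts, OF openin_strong_nbhds], assumption+) (use S in blast)+
qed

end

theorem theorem1: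
  fixes A :: "('a::{t2_space, second_countable_topology}, 'v::real_inner) chart set"
    and B :: "('b::{t2_space, second_countable_topology}, 'w::real_inner) chart set"
    and m d :: nat
    and F :: "('v, 'w) seminorms"
  assumes "has_dimension TYPE('v) m" and "smooth_structure A"
    and "has_dimension TYPE('w) d" and "smooth_structure B"
    and "seminorm_family F" and "banach_family F"
    and "composition_property F" and "gluing_property F" and "monotonicity_property F"
  shows "baire_property (weak_whitney_topology F A B) \<and>
         baire_property (strong_whitney_topology F A B)"
proof -
  interpret whitney F A B m d
    using assms by unfold_locales
  interpret weak: whitney_topology F A B m d finite "weak_whitney_topology F A B"
    by unfold_locales (simp_all add: weak_openin_iff)
  interpret strong: whitney_topology F A B m d locally_finite_charts "strong_whitney_topology F A B"
    by unfold_locales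
      (simp_all add: locally_finite_charts_finite locally_finite_charts_Un
        locally_finite_charts_image strong_openin_iff)
  show ?thesis
    using weak.baire_property_X strong.baire_property_X by blast
qed

end
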